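(* Let $\mathcal A$ be an abelian category and $\mathcal T$ a Serre class in $\mathcal A$. Let $\underline{\mathcal A}=\mathcal A/\langle\mathcal T\rangle$ be the stable category of $\mathcal A$ associated to $\mathcal T$. The following assertions are equivalent: 1) $\mathcal T$ is contravariantly (respectively, covariantly) finite in $\mathcal A$ and $\underline{\mathcal A}$ is balanced. 2) $\mathcal T$ is functorially finite in $\mathcal A$ and $\underline{\mathcal A}$ is weakly balanced. 3) $(\mathcal T,\mathcal T^{\perp})$ is a 2-decomposition of $\mathcal A$.
   Context: A Serre class is a full subcategory $\mathcal T$ such that for every short exact sequence $0\to L\to M\to N\to 0$ one has $M\in\mathcal T$ iff $L,N\in\mathcal T$. $\mathcal T^\perp$ is the full subcategory of objects $M$ with $\mathcal A(T,M)=0$ for all $T\in\mathcal T$. A 2-decomposition of $\mathcal A$ is a pair $(\mathcal X,\mathcal Y)$ of full subcategories closed under isomorphisms with $\mathcal A(X,Y)=\mathcal A(Y,X)=0$ for $X\in\mathcal X,Y\in\mathcal Y$ and such that every object of $\mathcal A$ is the coproduct of an object of $\mathcal X$ and an object of $\mathcal Y$. The stable category $\underline{\mathcal A}$ is the quotient of $\mathcal A$ by the ideal of morphisms factoring through an object of $\mathcal T$; $\overline f$ denotes the class of $f$. A category is balanced if every morphism that is both a monomorphism and an epimorphism is an isomorphism. A $\mathcal T$-preenvelope of $M$ is a morphism $M\to T^M$ with $T^M\in\mathcal T$ such that $\mathcal A(T^M,T)\to\mathcal A(M,T)$ is surjective for all $T\in\mathcal T$; a $\mathcal T$-precover $T_M\to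 M$ is the dual notion. $\mathcal T$ is covariantly (resp. contravariantly) finite if every object has a $\mathcal T$-preenvelope (resp. $\mathcal T$-precover), functorially finite if both. If $\mathcal T$ is functorially finite, $\underline{\mathcal A}$ is pretriangulated as follows. Fix for each $M$ a right exact sequence $M\xrightarrow{i_M}T^M\to\Sigma M\to 0$ with $i_M$ a $\mathcal T$-preenvelope. For $f:L\to M$, the pushout of $i_L$ and $f$ gives $g:M\to N$, and, together with the induced $h:N\to\Sigma L$ (vanishing on $M$ and agreeing with $T^L\to\Sigma L$ on $T^L$), a sequence $L\xrightarrow{\overline f}M\xrightarrow{\overline g}N\xrightarrow{\overline h}\Sigma L$; the right triangles are the sequences isomorphic in $\underline{\mathcal A}$ to these. Left triangles $\Omega N\to L\to M\to N$ are defined dually using precovers, kernels and pullbacks. $\underline{\mathcal A}$ is weakly balanced if a morphism $\alpha:M\to N$ of $\underline{\mathcal A}$ is an isomorphism whenever there exist a left triangle $\Omega N\to 0\to M\xrightarrow{\alpha}N$ and a right triangle $M\xrightarrow{\alpha}N\to 0\to\Sigma M$. *)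

theory Defs
  imports "HOL-Algebra.Group"
begin

record ('o, 'm) cat =
  Obj :: "'o set"
  Arr :: "'m set"
  Dom :: "'m \<Rightarrow> 'o"
  Cod :: "'m \<Rightarrow> 'o"
  Id :: "'o \<Rightarrow> 'm"
  Comp :: "'m \<Rightarrow> 'm \<Rightarrow> 'm"  (infixl "\<cdot>\<index>" 70)

record ('o, 'm) additive_cat = "('o, 'm) cat" +
  Add :: "'m \<Rightarrow> 'm \<Rightarrow> 'm"
  Zero :: "'o \<Rightarrow> 'o \<Rightarrow> 'm"

text \<open>As usual, \<open>g \<cdot> f\<close> means first \<open>f\<close>, then \<open>g\<close>; it is only meaningful
  if the codomain of \<open>f\<close> is the domain of \<open>g\<close>.\<close>

definition Hom :: "('o, 'm, 'z) cat_scheme \<Rightarrow> 'o \<Rightarrow> 'o \<Rightarrow> 'm set" where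
  "Hom C M N = {f \<in> Arr C. Dom C f = M \<and> Cod C f = N}"

locale category =
  fixes C :: "('o, 'm, 'z) cat_scheme" (structure)
  assumes Dom_Obj: "f \<in> Arr C \<Longrightarrow> Dom C f \<in> Obj C"
    and Cod_Obj: "f \<in> Arr C \<Longrightarrow> Cod C f \<in> Obj C"
    and Id_Hom: "M \<in> Obj C \<Longrightarrow> Id C M \<in> Hom C M M"
    and Comp_Hom: "f \<in> Hom C L M \<Longrightarrow> g \<in> Hom C M N \<Longrightarrow> g \<cdot> f \<in> Hom C L N"
    and Comp_assoc: "f \<in> Hom C K L \<Longrightarrow> g \<in> Hom C L M \<Longrightarrow> h \<in> Hom C M N \<Longrightarrow>
      h \<cdot> (g \<cdot> f) = (h \<cdot> g) \<cdot> f"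
    and Comp_Id: "f \<in> Hom C M N \<Longrightarrow> f \<cdot> Id C M = f"
    and Id_Comp: "f \<in> Hom C M N \<Longrightarrow> Id C N \<cdot> f = f"

definition monic :: "('o, 'm, 'z) cat_scheme \<Rightarrow> 'm \<Rightarrow> bool" where
  "monic C f \<longleftrightarrow> f \<in> Arr C \<and>
    (\<forall>X\<in>Obj C. \<forall>u\<in>Hom C X (Dom C f). \<forall>v\<in>Hom C X (Dom C f).
      f \<cdot>\<^bsub>C\<^esub> u = f \<cdot>\<^bsub>C\<^esub> v \<longrightarrow> u = v)"

definition epic :: "('o, 'm, 'z) cat_scheme \<Rightarrow> 'm \<Rightarrow> bool" where
  "epic C f \<longleftrightarrow> f \<in> Arr C \<and>
    (\<forall>X\<in>Obj C. \<forall>u\<in>Hom C (Cod C f) X. \<forall>v\<in>Hom C (Cod C f) X.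
      u \<cdot>\<^bsub>C\<^esub> f = v \<cdot>\<^bsub>C\<^esub> f \<longrightarrow> u = v)"

definition is_isom :: "('o, 'm, 'z) cat_scheme \<Rightarrow> 'm \<Rightarrow> bool" where
  "is_isom C f \<longleftrightarrow> f \<in> Arr C \<and>
    (\<exists>g\<in>Hom C (Cod C f) (Dom C f).
      g \<cdot>\<^bsub>C\<^esub> f = Id C (Dom C f) \<and> f \<cdot>\<^bsub>C\<^esub> g = Id C (Cod C f))"

definition isomorphic :: "('o, 'm, 'z) cat_scheme \<Rightarrow> 'o \<Rightarrow> 'o \<Rightarrow> bool" where
  "isomorphic C M N \<longleftrightarrow> (\<exists>f\<in>Hom C M N. is_isom C f)"

definition balanced :: "('o, 'm, 'z) cat_scheme \<Rightarrow> bool" where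
  "balanced C \<longleftrightarrow> (\<forall>f\<in>Arr C. monic C f \<and> epic C f \<longrightarrow> is_isom C f)"

definition zero_object :: "('o, 'm, 'z) cat_scheme \<Rightarrow> 'o \<Rightarrow> bool" where
  "zero_object C Z \<longleftrightarrow> Z \<in> Obj C \<and>
    (\<forall>M\<in>Obj C. (\<exists>!f. f \<in> Hom C Z M) \<and> (\<exists>!f. f \<in> Hom C M Z))"

definition is_coproduct :: "('o, 'm, 'z) cat_scheme \<Rightarrow> 'o \<Rightarrow> 'o \<Rightarrow> 'o \<Rightarrow> 'm \<Rightarrow> 'm \<Rightarrow> bool" where
  "is_coproduct C X Y M a b \<longleftrightarrow> a \<in> Hom C X M \<and> b \<in> Hom C Y M \<and>
    (\<forall>Z\<in>Obj C. \<forall>u\<in>Hom C X Z. \<forall>v\<in>Hom C Y Z.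
      \<exists>!w. w \<in> Hom C M Z \<and> w \<cdot>\<^bsub>C\<^esub> a = u \<and> w \<cdot>\<^bsub>C\<^esub> b = v)"

definition is_product :: "('o, 'm, 'z) cat_scheme \<Rightarrow> 'o \<Rightarrow> 'o \<Rightarrow> 'o \<Rightarrow> 'm \<Rightarrow> 'm \<Rightarrow> bool" where
  "is_product C X Y M p q \<longleftrightarrow> p \<in> Hom C M X \<and> q \<in> Hom C M Y \<and>
    (\<forall>Z\<in>Obj C. \<forall>u\<in>Hom C Z X. \<forall>v\<in>Hom C Z Y.
      \<exists>!w. w \<in> Hom C Z M \<and> p \<cdot>\<^bsub>C\<^esub> w = u \<and> q \<cdot>\<^bsub>C\<^esub> w = v)"

definition is_kernel :: "('o, 'm, 'z) additive_cat_scheme \<Rightarrow> 'm \<Rightarrow> 'm \<Rightarrow> bool" where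
  "is_kernel C k f \<longleftrightarrow> k \<in> Arr C \<and> f \<in> Arr C \<and> Cod C k = Dom C f \<and>
    f \<cdot>\<^bsub>C\<^esub> k = Zero C (Dom C k) (Cod C f) \<and>
    (\<forall>X\<in>Obj C. \<forall>u\<in>Hom C X (Dom C f). f \<cdot>\<^bsub>C\<^esub> u = Zero C X (Cod C f) \<longrightarrow>
      (\<exists>!w. w \<in> Hom C X (Dom C k) \<and> k \<cdot>\<^bsub>C\<^esub> w = u))"

definition is_cokernel :: "('o, 'm, 'z) additive_cat_scheme \<Rightarrow> 'm \<Rightarrow> 'm \<Rightarrow> bool" where
  "is_cokernel C f q \<longleftrightarrow> f \<in> Arr C \<and> q \<in> Arr C \<and> Cod C f = Dom C q \<and>
    q \<cdot>\<^bsub>C\<^esub> f = Zero C (Dom C f) (Cod C q) \<and>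
    (\<forall>X\<in>Obj C. \<forall>u\<in>Hom C (Cod C f) X. u \<cdot>\<^bsub>C\<^esub> f = Zero C (Dom C f) X \<longrightarrow>
      (\<exists>!w. w \<in> Hom C (Cod C q) X \<and> w \<cdot>\<^bsub>C\<^esub> q = u))"

definition is_pushout ::
  "('o, 'm, 'z) cat_scheme \<Rightarrow> 'm \<Rightarrow> 'm \<Rightarrow> 'm \<Rightarrow> 'm \<Rightarrow> bool" where
  \<comment> \<open>the square \<open>t \<cdot> i = g \<cdot> f\<close> is a pushout of \<open>i\<close> and \<open>f\<close>\<close>
  "is_pushout C i f t g \<longleftrightarrow> i \<in> Arr C \<and> f \<in> Arr C \<and> Dom C i = Dom C f \<and>
    t \<in> Arr C \<and> g \<in> Hom C (Cod C f) (Cod C t) \<and> Dom C t = Cod C i \<and>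
    t \<cdot>\<^bsub>C\<^esub> i = g \<cdot>\<^bsub>C\<^esub> f \<and>
    (\<forall>X\<in>Obj C. \<forall>u\<in>Hom C (Cod C i) X. \<forall>v\<in>Hom C (Cod C f) X.
      u \<cdot>\<^bsub>C\<^esub> i = v \<cdot>\<^bsub>C\<^esub> f \<longrightarrow>
      (\<exists>!w. w \<in> Hom C (Cod C t) X \<and> w \<cdot>\<^bsub>C\<^esub> t = u \<and> w \<cdot>\<^bsub>C\<^esub> g = v))"

locale preadditive_category = category C
  for C :: "('o, 'm, 'z) additive_cat_scheme" (structure) +
  assumes Hom_comm_group: "M \<in> Obj C \<Longrightarrow> N \<in> Obj C \<Longrightarrow>
      comm_group \<lparr>carrier = Hom C M N, monoid.mult = Add C, one = Zero C M N\<rparr>"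
    and Comp_Add_left: "f \<in> Hom C L M \<Longrightarrow> g \<in> Hom C M N \<Longrightarrow> g' \<in> Hom C M N \<Longrightarrow>
      Add C g g' \<cdot> f = Add C (g \<cdot> f) (g' \<cdot> f)"
    and Comp_Add_right: "f \<in> Hom C L M \<Longrightarrow> f' \<in> Hom C L M \<Longrightarrow> g \<in> Hom C M N \<Longrightarrow>
      g \<cdot> Add C f f' = Add C (g \<cdot> f) (g \<cdot> f')"

locale abelian_category = preadditive_category C
  for C :: "('o, 'm, 'z) additive_cat_scheme" (structure) +
  assumes ex_zero_object: "\<exists>Z. zero_object C Z"
    and ex_coproduct: "X \<in> Obj C \<Longrightarrow> Y \<in> Obj C \<Longrightarrow> \<exists>M a b. is_coproduct C X Y M a b"
    and ex_product: "X \<in> Obj C \<Longrightarrow> Y \<in> Obj C \<Longrightarrow> \<exists>M p q. is_product C X Y M p q"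
    and ex_kernel: "f \<in> Arr C \<Longrightarrow> \<exists>k. is_kernel C k f"
    and ex_cokernel: "f \<in> Arr C \<Longrightarrow> \<exists>q. is_cokernel C f q"
    and monic_is_kernel: "monic C f \<Longrightarrow> \<exists>g. is_kernel C f g"
    and epic_is_cokernel: "epic C f \<Longrightarrow> \<exists>g. is_cokernel C g f"

definition op_cat :: "('o, 'm) additive_cat \<Rightarrow> ('o, 'm) additive_cat" where
  "op_cat C = C\<lparr>Dom := Cod C, Cod := Dom C, Comp := (\<lambda>g f. f \<cdot>\<^bsub>C\<^esub> g),
     Zero := (\<lambda>M N. Zero C N M)\<rparr>"

text \<open>Full subcategories are represented by their sets of objects.\<close>

definition short_exact :: "('o, 'm) additive_cat \<Rightarrow> 'm \<Rightarrow> 'm \<Rightarrow> bool" where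
  "short_exact C f g \<longleftrightarrow> is_kernel C f g \<and> is_cokernel C f g"

definition serre_class :: "('o, 'm) additive_cat \<Rightarrow> 'o set \<Rightarrow> bool" where
  "serre_class C \<T> \<longleftrightarrow> \<T> \<subseteq> Obj C \<and>
    (\<forall>L M N. \<forall>f\<in>Hom C L M. \<forall>g\<in>Hom C M N. short_exact C f g \<longrightarrow>
      (M \<in> \<T> \<longleftrightarrow> L \<in> \<T> \<and> N \<in> \<T>))"

definition perp :: "('o, 'm) additive_cat \<Rightarrow> 'o set \<Rightarrow> 'o set" where
  "perp C \<T> = {M \<in> Obj C. \<forall>T\<in>\<T>. Hom C T M = {Zero C T M}}"

definition iso_closed :: "('o, 'm) additive_cat \<Rightarrow> 'o set \<Rightarrow> bool" where
  "iso_closed C \<X> \<longleftrightarrow> (\<forall>M\<in>\<X>. \<forall>N\<in>Obj C. isomorphic C M N \<longrightarrow> N \<in> \<X>)"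

definition two_decomposition :: "('o, 'm) additive_cat \<Rightarrow> 'o set \<Rightarrow> 'o set \<Rightarrow> bool" where
  "two_decomposition C \<X> \<Y> \<longleftrightarrow>
    \<X> \<subseteq> Obj C \<and> \<Y> \<subseteq> Obj C \<and> iso_closed C \<X> \<and> iso_closed C \<Y> \<and>
    (\<forall>X\<in>\<X>. \<forall>Y\<in>\<Y>. Hom C X Y = {Zero C X Y} \<and> Hom C Y X = {Zero C Y X}) \<and>
    (\<forall>M\<in>Obj C. \<exists>X\<in>\<X>. \<exists>Y\<in>\<Y>. \<exists>a b. is_coproduct C X Y M a b)"

definition preenvelope :: "('o, 'm) additive_cat \<Rightarrow> 'o set \<Rightarrow> 'o \<Rightarrow> 'm \<Rightarrow> bool" where
  "preenvelope C \<T> M i \<longleftrightarrow> i \<in> Arr C \<and> Dom C i = M \<and> Cod C i \<in> \<T> \<and>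
    (\<forall>T\<in>\<T>. \<forall>g\<in>Hom C M T. \<exists>h\<in>Hom C (Cod C i) T. h \<cdot>\<^bsub>C\<^esub> i = g)"

definition precover :: "('o, 'm) additive_cat \<Rightarrow> 'o set \<Rightarrow> 'o \<Rightarrow> 'm \<Rightarrow> bool" where
  "precover C \<T> M j \<longleftrightarrow> preenvelope (op_cat C) \<T> M j"

definition covariantly_finite :: "('o, 'm) additive_cat \<Rightarrow> 'o set \<Rightarrow> bool" where
  "covariantly_finite C \<T> \<longleftrightarrow> (\<forall>M\<in>Obj C. \<exists>i. preenvelope C \<T> M i)"

definition contravariantly_finite :: "('o, 'm) additive_cat \<Rightarrow> 'o set \<Rightarrow> bool" where
  "contravariantly_finite C \<T> \<longleftrightarrow> (\<forall>M\<in>Obj C. \<exists>j. precover C \<T> M j)"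

definition functorially_finite :: "('o, 'm) additive_cat \<Rightarrow> 'o set \<Rightarrow> bool" where
  "functorially_finite C \<T> \<longleftrightarrow> covariantly_finite C \<T> \<and> contravariantly_finite C \<T>"

definition factors_through :: "('o, 'm) additive_cat \<Rightarrow> 'o set \<Rightarrow> 'm \<Rightarrow> bool" where
  "factors_through C \<T> f \<longleftrightarrow>
    (\<exists>T\<in>\<T>. \<exists>u\<in>Hom C (Dom C f) T. \<exists>v\<in>Hom C T (Cod C f). f = v \<cdot>\<^bsub>C\<^esub> u)"

text \<open>The class of \<open>f : M \<rightarrow> N\<close> is its coset modulo the subgroup of morphisms
  \<open>M \<rightarrow> N\<close> that factor through an object of \<open>\<T>\<close>.\<close>

definition stable_class :: "('o, 'm) additive_cat \<Rightarrow> 'o set \<Rightarrow> 'm \<Rightarrow> 'm set" where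
  "stable_class C \<T> f =
    {Add C f t | t. t \<in> Hom C (Dom C f) (Cod C f) \<and> factors_through C \<T> t}"

definition stable_cat :: "('o, 'm) additive_cat \<Rightarrow> 'o set \<Rightarrow> ('o, 'm set) additive_cat" where
  "stable_cat C \<T> =
    \<lparr>Obj = Obj C,
     Arr = stable_class C \<T> ` Arr C,
     Dom = (\<lambda>F. Dom C (SOME f. f \<in> F)),
     Cod = (\<lambda>F. Cod C (SOME f. f \<in> F)),
     Id = (\<lambda>M. stable_class C \<T> (Id C M)),
     Comp = (\<lambda>G F. \<Union>g\<in>G. \<Union>f\<in>F. stable_class C \<T> (g \<cdot>\<^bsub>C\<^esub> f)),
     Add = (\<lambda>F G. \<Union>f\<in>F. \<Union>g\<in>G. stable_class C \<T> (Add C f g)),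
     Zero = (\<lambda>M N. stable_class C \<T> (Zero C M N))\<rparr>"

text \<open>A choice, for every object \<open>M\<close>, of a right exact sequence
  \<open>M \<rightarrow> T\<^sup>M \<rightarrow> \<Sigma> M \<rightarrow> 0\<close> with first morphism \<open>i M\<close> a preenvelope and second
  morphism \<open>q M\<close>. Hence \<open>T\<^sup>M = Cod C (i M)\<close> and \<open>\<Sigma> M = Cod C (q M)\<close>.\<close>

definition preenvelope_choice ::
  "('o, 'm) additive_cat \<Rightarrow> 'o set \<Rightarrow> ('o \<Rightarrow> 'm) \<Rightarrow> ('o \<Rightarrow> 'm) \<Rightarrow> bool" where
  "preenvelope_choice C \<T> i q \<longleftrightarrow>
    (\<forall>M\<in>Obj C. preenvelope C \<T> M (i M) \<and> is_cokernel C (i M) (q M))"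

text \<open>Dually, left exact sequences \<open>0 \<rightarrow> \<Omega> M \<rightarrow> T\<^sub>M \<rightarrow> M\<close> with second morphism
  \<open>j M\<close> a precover and first morphism \<open>k M\<close>.\<close>

definition precover_choice ::
  "('o, 'm) additive_cat \<Rightarrow> 'o set \<Rightarrow> ('o \<Rightarrow> 'm) \<Rightarrow> ('o \<Rightarrow> 'm) \<Rightarrow> bool" where
  "precover_choice C \<T> j k \<longleftrightarrow>
    (\<forall>M\<in>Obj C. precover C \<T> M (j M) \<and> is_kernel C (k M) (j M))"

text \<open>The action of \<open>\<Sigma>\<close> on morphisms, as a relation: \<open>S = \<Sigma> F\<close>, where \<open>F\<close> is the class
  of \<open>f : L \<rightarrow> L'\<close>, and \<open>S\<close> the class of the morphism \<open>\<Sigma> L \<rightarrow> \<Sigma> L'\<close> induced on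
  cokernels by some \<open>u : Cod C (i L) \<rightarrow> Cod C (i L')\<close> extending \<open>f\<close>.\<close>

definition is_suspension_of ::
  "('o, 'm) additive_cat \<Rightarrow> 'o set \<Rightarrow> ('o \<Rightarrow> 'm) \<Rightarrow> ('o \<Rightarrow> 'm) \<Rightarrow> 'm set \<Rightarrow> 'm set \<Rightarrow> bool" where
  "is_suspension_of C \<T> i q S F \<longleftrightarrow>
    (\<exists>L\<in>Obj C. \<exists>L'\<in>Obj C.
      \<exists>f\<in>Hom C L L'. \<exists>u\<in>Hom C (Cod C (i L)) (Cod C (i L')).
      \<exists>s\<in>Hom C (Cod C (q L)) (Cod C (q L')).
        u \<cdot>\<^bsub>C\<^esub> i L = i L' \<cdot>\<^bsub>C\<^esub> f \<and> s \<cdot>\<^bsub>C\<^esub> q L = q L' \<cdot>\<^bsub>C\<^esub> u \<and>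
        F = stable_class C \<T> f \<and> S = stable_class C \<T> s)"

definition standard_right_triangle ::
  "('o, 'm) additive_cat \<Rightarrow> 'o set \<Rightarrow> ('o \<Rightarrow> 'm) \<Rightarrow> ('o \<Rightarrow> 'm) \<Rightarrow>
    'm set \<Rightarrow> 'm set \<Rightarrow> 'm set \<Rightarrow> bool" where
  "standard_right_triangle C \<T> i q F G H \<longleftrightarrow>
    (\<exists>L\<in>Obj C. \<exists>M\<in>Obj C. \<exists>N\<in>Obj C.
      \<exists>f\<in>Hom C L M. \<exists>g\<in>Hom C M N. \<exists>t\<in>Hom C (Cod C (i L)) N. \<exists>h\<in>Hom C N (Cod C (q L)).
        is_pushout C (i L) f t g \<and>
        h \<cdot>\<^bsub>C\<^esub> g = Zero C M (Cod C (q L)) \<and> h \<cdot>\<^bsub>C\<^esub> t = q L \<and>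
        F = stable_class C \<T> f \<and> G = stable_class C \<T> g \<and> H = stable_class C \<T> h)"

text \<open>A sequence \<open>L \<rightarrow> M \<rightarrow> N \<rightarrow> \<Sigma> L\<close> with morphisms \<open>F\<close>, \<open>G\<close>, \<open>H\<close> is a right triangle
  if it is isomorphic, by means of isomorphisms \<open>A\<close>, \<open>B\<close>, \<open>D\<close> and \<open>S = \<Sigma> A\<close>, to a standard one.\<close>

definition right_triangle ::
  "('o, 'm) additive_cat \<Rightarrow> 'o set \<Rightarrow> ('o \<Rightarrow> 'm) \<Rightarrow> ('o \<Rightarrow> 'm) \<Rightarrow>
    'm set \<Rightarrow> 'm set \<Rightarrow> 'm set \<Rightarrow> bool" where
  "right_triangle C \<T> i q F G H \<longleftrightarrow>
    (let \<S> = stable_cat C \<T> in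
    \<exists>L\<in>Obj C. \<exists>M\<in>Obj C. \<exists>N\<in>Obj C. \<exists>L'\<in>Obj C. \<exists>M'\<in>Obj C. \<exists>N'\<in>Obj C.
      F \<in> Hom \<S> L M \<and> G \<in> Hom \<S> M N \<and> H \<in> Hom \<S> N (Cod C (q L)) \<and>
      (\<exists>F'\<in>Hom \<S> L' M'. \<exists>G'\<in>Hom \<S> M' N'. \<exists>H'\<in>Hom \<S> N' (Cod C (q L')).
        standard_right_triangle C \<T> i q F' G' H' \<and>
        (\<exists>A\<in>Hom \<S> L L'. \<exists>B\<in>Hom \<S> M M'. \<exists>D\<in>Hom \<S> N N'.
         \<exists>S\<in>Hom \<S> (Cod C (q L)) (Cod C (q L')).
          is_isom \<S> A \<and> is_isom \<S> B \<and> is_isom \<S> D \<and> is_isom \<S> S \<and>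
          is_suspension_of C \<T> i q S A \<and>
          F' \<cdot>\<^bsub>\<S>\<^esub> A = B \<cdot>\<^bsub>\<S>\<^esub> F \<and> G' \<cdot>\<^bsub>\<S>\<^esub> B = D \<cdot>\<^bsub>\<S>\<^esub> G \<and>
          H' \<cdot>\<^bsub>\<S>\<^esub> D = S \<cdot>\<^bsub>\<S>\<^esub> H)))"

text \<open>A sequence \<open>\<Omega> N \<rightarrow> L \<rightarrow> M \<rightarrow> N\<close> with morphisms \<open>H\<close>, \<open>G\<close>, \<open>F\<close> is a left triangle if
  it is a right triangle for the opposite category: there, \<open>j\<close>, \<open>k\<close> play the role of
  preenvelopes and their cokernels, pullbacks become pushouts, and a morphism of \<open>C\<close> has the
  same stable class in both categories.\<close>

definition left_triangle ::
  "('o, 'm) additive_cat \<Rightarrow> 'o set \<Rightarrow> ('o \<Rightarrow> 'm) \<Rightarrow> ('o \<Rightarrow> 'm) \<Rightarrow>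
    'm set \<Rightarrow> 'm set \<Rightarrow> 'm set \<Rightarrow> bool" where
  "left_triangle C \<T> j k H G F \<longleftrightarrow> right_triangle (op_cat C) \<T> j k F G H"

definition weakly_balanced ::
  "('o, 'm) additive_cat \<Rightarrow> 'o set \<Rightarrow> ('o \<Rightarrow> 'm) \<Rightarrow> ('o \<Rightarrow> 'm) \<Rightarrow>
    ('o \<Rightarrow> 'm) \<Rightarrow> ('o \<Rightarrow> 'm) \<Rightarrow> bool" where
  "weakly_balanced C \<T> i q j k \<longleftrightarrow>
    (let \<S> = stable_cat C \<T> in
    \<forall>M\<in>Obj C. \<forall>N\<in>Obj C. \<forall>F\<in>Hom \<S> M N.
      (\<exists>Z. zero_object \<S> Z \<and>
        (\<exists>H\<in>Hom \<S> (Dom C (k N)) Z. \<exists>G\<in>Hom \<S> Z M. left_triangle C \<T> j k H G F)) \<and>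
      (\<exists>Z. zero_object \<S> Z \<and>
        (\<exists>G\<in>Hom \<S> N Z. \<exists>H\<in>Hom \<S> Z (Cod C (q M)). right_triangle C \<T> i q F G H))
      \<longrightarrow> is_isom \<S> F)"

end

theory Submission
  imports Defs
begin

text \<open>
  All conditions are compared with a self-dual one, \<open>splits\<close>: every object is a biproduct of an
  object of \<open>\<T>\<close> and an object without nonzero morphisms from or to \<open>\<T>\<close>. This is easily
  seen to mean that \<open>(\<T>, \<T>\<^sup>\<bottom>)\<close> is a 2-decomposition (\<open>splits_iff_two_decomposition\<close>).

  Call a morphism small if it factors through \<open>\<T>\<close>, that is, vanishes in the stable category, and
  a Serre isomorphism if its kernel and cokernel lie in \<open>\<T>\<close>. Closure of \<open>\<T>\<close> under
  subobjects, quotients and extensions yields that \<open>u\<close> is small if \<open>f \<cdot> u\<close> is and the kernel of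
  \<open>f\<close> is in \<open>\<T>\<close> (\<open>small_cancel_left\<close>). Hence Serre isomorphisms are monic and epic in the
  stable category, and invertible there if it is balanced. Weak balancedness has the same effect when
  \<open>\<T>\<close> is functorially finite: the pushout of a preenvelope along a Serre isomorphism \<open>f\<close>
  lies in \<open>\<T>\<close>, so \<open>f\<close> is part of a right triangle with zero third term
  (\<open>right_triangle_zero_cone\<close>), and dually of a left one.

  Now let Serre isomorphisms be stably invertible and let \<open>M\<close> have a \<open>\<T>\<close>-precover. Its image is
  the largest subobject of \<open>M\<close> in \<open>\<T>\<close>, the quotient \<open>N\<close> lies in \<open>\<T>\<^sup>\<bottom>\<close>, and
  \<open>M \<rightarrow> N\<close> is a Serre isomorphism. Small morphisms into \<open>N\<close> are zero, so its stable inverse is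
  an honest section and \<open>M\<close> splits. A morphism from \<open>N\<close> to an object of \<open>\<T>\<close> is
  zero, because the inclusion of its kernel is a Serre isomorphism and has a section in the same way
  (\<open>splits_if_contravariantly_finite\<close>). With preenvelopes instead of precovers one argues in the
  opposite category.

  Conversely, in the presence of splittings the summand in \<open>\<T>\<close> provides both precover and
  preenvelope, and the stable category is equivalent to the full subcategory of the other summands,
  where stably monic and epic morphisms are monic and epic in the abelian category \<open>C\<close>
  (\<open>splits_imp_balanced\<close>). Finally, balanced implies weakly balanced, because the second morphism
  of a right triangle is a weak cokernel of the first, which is thus epic if the third object is zero
  (\<open>right_triangle_zero_cone_epic\<close>).
\<close>

section \<open>Morphisms in a preadditive category\<close>

lemma monic_Arr: "monic C f \<Longrightarrow> f \<in> Arr C"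
  by (simp add: monic_def)

context category
begin

text \<open>All computations below are done on morphisms with equations between their domains and codomains
  rather than with membership in Hom sets: the simplifier can then decide composability without
  guessing intermediate objects.\<close>

lemma Hom_iff: "f \<in> Hom C M N \<longleftrightarrow> f \<in> Arr C \<and> Dom C f = M \<and> Cod C f = N"
  by (simp add: Hom_def)

declare Dom_Obj [simp] Cod_Obj [simp]

lemma Id_simps [simp]:
  "M \<in> Obj C \<Longrightarrow> Id C M \<in> Arr C" "M \<in> Obj C \<Longrightarrow> Dom C (Id C M) = M"
  "M \<in> Obj C \<Longrightarrow> Cod C (Id C M) = M"
  using Id_Hom[of M] by (auto simp: Hom_iff)

lemma Comp_simps [simp]:
  assumes "f \<in> Arr C" "g \<in> Arr C" "Dom C g = Cod C f"
  shows "g \<cdot> f \<in> Arr C" "Dom C (g \<cdot> f) = Dom C f" "Cod C (g \<cdot> f) = Cod C g"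
  using Comp_Hom[of f "Dom C f" "Cod C f" g "Cod C g"] assms by (auto simp: Hom_iff)

lemma Comp_reassoc [simp]:
  assumes "f \<in> Arr C" "g \<in> Arr C" "h \<in> Arr C" "Dom C g = Cod C f" "Dom C h = Cod C g"
  shows "(h \<cdot> g) \<cdot> f = h \<cdot> (g \<cdot> f)"
  using Comp_assoc[of f "Dom C f" "Cod C f" g "Cod C g" h "Cod C h"] assms by (auto simp: Hom_iff)

lemma Comp_Id_simps [simp]:
  "f \<in> Arr C \<Longrightarrow> M = Dom C f \<Longrightarrow> f \<cdot> Id C M = f"
  "f \<in> Arr C \<Longrightarrow> M = Cod C f \<Longrightarrow> Id C M \<cdot> f = f"
  using Comp_Id[of f] Id_Comp[of f] by (auto simp: Hom_iff)

text \<open>Composites are normalized to associate to the right; this extends an equation between composites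
  so that it still applies inside a longer one.\<close>

lemma Comp_extend:
  assumes "g \<cdot> f = h" "x \<in> Arr C" "f \<in> Arr C" "g \<in> Arr C" "Dom C f = Cod C x" "Dom C g = Cod C f"
  shows "g \<cdot> (f \<cdot> x) = h \<cdot> x"
  using Comp_reassoc[of x f g] assms by simp

lemma monicD:
  assumes "monic C f" "f \<cdot> u = f \<cdot> v" "u \<in> Arr C" "v \<in> Arr C" "Cod C u = Dom C f"
    "Cod C v = Dom C f" "Dom C u = Dom C v"
  shows "u = v"
proof -
  have "u \<in> Hom C (Dom C u) (Dom C f)" "v \<in> Hom C (Dom C u) (Dom C f)" "Dom C u \<in> Obj C"
    using assms by (auto simp: Hom_iff)
  then show ?thesis using assms(1,2) unfolding monic_def by blast
qed

lemma epicD: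
  assumes "epic C f" "u \<cdot> f = v \<cdot> f" "u \<in> Arr C" "v \<in> Arr C" "Dom C u = Cod C f"
    "Dom C v = Cod C f" "Cod C u = Cod C v"
  shows "u = v"
proof -
  have "u \<in> Hom C (Cod C f) (Cod C u)" "v \<in> Hom C (Cod C f) (Cod C u)" "Cod C u \<in> Obj C"
    using assms by (auto simp: Hom_iff)
  then show ?thesis using assms(1,2) unfolding epic_def by blast
qed

end

abbreviation hom_group :: "('o, 'm, 'z) additive_cat_scheme \<Rightarrow> 'o \<Rightarrow> 'o \<Rightarrow> 'm monoid" where
  "hom_group C M N \<equiv> \<lparr>carrier = Hom C M N, monoid.mult = Add C, one = Zero C M N\<rparr>"

context preadditive_category
begin

abbreviation add (infixl "\<oplus>" 65) where "f \<oplus> g \<equiv> Add C f g"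

definition neg :: "'m \<Rightarrow> 'm" where
  "neg f = inv\<^bsub>hom_group C (Dom C f) (Cod C f)\<^esub> f"

lemma Zero_simps [simp]:
  assumes "M \<in> Obj C" "N \<in> Obj C"
  shows "Zero C M N \<in> Arr C" "Dom C (Zero C M N) = M" "Cod C (Zero C M N) = N"
proof -
  interpret comm_group "hom_group C M N" by (rule Hom_comm_group[OF assms])
  show "Zero C M N \<in> Arr C" "Dom C (Zero C M N) = M" "Cod C (Zero C M N) = N"
    using one_closed by (auto simp: Hom_iff)
qed

lemma Add_simps [simp]:
  assumes "f \<in> Arr C" "g \<in> Arr C" "Dom C g = Dom C f" "Cod C g = Cod C f"
  shows "f \<oplus> g \<in> Arr C" "Dom C (f \<oplus> g) = Dom C f" "Cod C (f \<oplus> g) = Cod C f"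
proof -
  interpret comm_group "hom_group C (Dom C f) (Cod C f)"
    by (rule Hom_comm_group) (use assms in auto)
  show "f \<oplus> g \<in> Arr C" "Dom C (f \<oplus> g) = Dom C f" "Cod C (f \<oplus> g) = Cod C f"
    using m_closed[of f g] assms by (auto simp: Hom_iff)
qed

lemma neg_simps [simp]:
  assumes "f \<in> Arr C"
  shows "neg f \<in> Arr C" "Dom C (neg f) = Dom C f" "Cod C (neg f) = Cod C f"
proof -
  interpret comm_group "hom_group C (Dom C f) (Cod C f)"
    by (rule Hom_comm_group) (use assms in auto)
  show "neg f \<in> Arr C" "Dom C (neg f) = Dom C f" "Cod C (neg f) = Cod C f"
    using inv_closed[of f] assms by (auto simp: Hom_iff neg_def)
qed

lemma Add_assoc:
  assumes "f \<in> Arr C" "g \<in> Arr C" "h \<in> Arr C" "Dom C g = Dom C f" "Cod C g = Cod C f"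
    "Dom C h = Dom C f" "Cod C h = Cod C f"
  shows "(f \<oplus> g) \<oplus> h = f \<oplus> (g \<oplus> h)"
proof -
  interpret comm_group "hom_group C (Dom C f) (Cod C f)"
    by (rule Hom_comm_group) (use assms in auto)
  show ?thesis using m_assoc[of f g h] assms by (auto simp: Hom_iff)
qed

lemma Add_commute:
  assumes "f \<in> Arr C" "g \<in> Arr C" "Dom C g = Dom C f" "Cod C g = Cod C f"
  shows "f \<oplus> g = g \<oplus> f"
proof -
  interpret comm_group "hom_group C (Dom C f) (Cod C f)"
    by (rule Hom_comm_group) (use assms in auto)
  show ?thesis using m_comm[of f g] assms by (auto simp: Hom_iff)
qed

lemma Add_left_commute:
  assumes "f \<in> Arr C" "g \<in> Arr C" "h \<in> Arr C" "Dom C g = Dom C f" "Cod C g = Cod C f"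
    "Dom C h = Dom C f" "Cod C h = Cod C f"
  shows "f \<oplus> (g \<oplus> h) = g \<oplus> (f \<oplus> h)"
  using Add_assoc[of f g h] Add_assoc[of g f h] Add_commute[of f g] assms by simp

lemma Add_Zero_simps [simp]:
  assumes "f \<in> Arr C" "M = Dom C f" "N = Cod C f"
  shows "f \<oplus> Zero C M N = f" "Zero C M N \<oplus> f = f"
proof -
  interpret comm_group "hom_group C (Dom C f) (Cod C f)"
    by (rule Hom_comm_group) (use assms in auto)
  show "f \<oplus> Zero C M N = f" "Zero C M N \<oplus> f = f"
    using l_one[of f] r_one[of f] assms by (auto simp: Hom_iff)
qed

lemma Add_neg_simps [simp]:
  assumes "f \<in> Arr C"
  shows "f \<oplus> neg f = Zero C (Dom C f) (Cod C f)" "neg f \<oplus> f = Zero C (Dom C f) (Cod C f)"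
proof -
  interpret comm_group "hom_group C (Dom C f) (Cod C f)"
    by (rule Hom_comm_group) (use assms in auto)
  show "f \<oplus> neg f = Zero C (Dom C f) (Cod C f)" "neg f \<oplus> f = Zero C (Dom C f) (Cod C f)"
    using l_inv[of f] r_inv[of f] assms by (auto simp: Hom_iff neg_def)
qed

lemma Add_neg_cancel [simp]:
  assumes "f \<in> Arr C" "g \<in> Arr C" "Dom C g = Dom C f" "Cod C g = Cod C f"
  shows "f \<oplus> (neg f \<oplus> g) = g" "neg f \<oplus> (f \<oplus> g) = g"
  using Add_assoc[of f "neg f" g] Add_assoc[of "neg f" f g] assms by auto

lemma neg_Zero [simp]:
  assumes "M \<in> Obj C" "N \<in> Obj C"
  shows "neg (Zero C M N) = Zero C M N"
proof -
  have "neg (Zero C M N) = Zero C M N \<oplus> neg (Zero C M N)"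
    by (rule Add_Zero_simps(2)[symmetric]) (use assms in simp_all)
  then show ?thesis using assms by simp
qed

lemma Add_right_imp_eq:
  assumes "f \<oplus> h = g \<oplus> h" "f \<in> Arr C" "g \<in> Arr C" "h \<in> Arr C" "Dom C g = Dom C f"
    "Cod C g = Cod C f" "Dom C h = Dom C f" "Cod C h = Cod C f"
  shows "f = g"
proof -
  have "(f \<oplus> h) \<oplus> neg h = (g \<oplus> h) \<oplus> neg h" using assms(1) by simp
  then show ?thesis using assms(2-) by (simp add: Add_assoc)
qed

lemma eq_iff_diff_zero:
  assumes "f \<in> Arr C" "g \<in> Arr C" "Dom C g = Dom C f" "Cod C g = Cod C f"
  shows "f = g \<longleftrightarrow> f \<oplus> neg g = Zero C (Dom C f) (Cod C f)"
  using Add_right_imp_eq[of f "neg g" g] assms by auto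

lemma Comp_Add_distrib [simp]:
  assumes "f \<in> Arr C" "g \<in> Arr C" "g' \<in> Arr C" "Dom C g = Cod C f" "Dom C g' = Cod C f"
    "Cod C g' = Cod C g"
  shows "(g \<oplus> g') \<cdot> f = g \<cdot> f \<oplus> g' \<cdot> f"
  using Comp_Add_left[of f "Dom C f" "Cod C f" g "Cod C g" g'] assms by (auto simp: Hom_iff)

lemma Comp_Add_distrib2 [simp]:
  assumes "g \<in> Arr C" "f \<in> Arr C" "f' \<in> Arr C" "Dom C g = Cod C f" "Cod C f' = Cod C f"
    "Dom C f' = Dom C f"
  shows "g \<cdot> (f \<oplus> f') = g \<cdot> f \<oplus> g \<cdot> f'"
  using Comp_Add_right[of f "Dom C f" "Cod C f" f' g "Cod C g"] assms by (auto simp: Hom_iff)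

lemma Comp_Zero [simp]:
  assumes "f \<in> Arr C" "M = Dom C f" "K \<in> Obj C"
  shows "f \<cdot> Zero C K M = Zero C K (Cod C f)"
proof -
  let ?z = "Zero C K M"
  have "f \<cdot> ?z \<oplus> f \<cdot> ?z = Zero C K (Cod C f) \<oplus> f \<cdot> ?z"
    by (subst Comp_Add_distrib2[symmetric]) (use assms in simp_all)
  then show ?thesis by (rule Add_right_imp_eq) (use assms in simp_all)
qed

lemma Zero_Comp [simp]:
  assumes "f \<in> Arr C" "M = Cod C f" "N \<in> Obj C"
  shows "Zero C M N \<cdot> f = Zero C (Dom C f) N"
proof -
  let ?z = "Zero C M N"
  have "?z \<cdot> f \<oplus> ?z \<cdot> f = Zero C (Dom C f) N \<oplus> ?z \<cdot> f"
    by (subst Comp_Add_distrib[symmetric]) (use assms in simp_all)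
  then show ?thesis by (rule Add_right_imp_eq) (use assms in simp_all)
qed

lemma neg_Comp [simp]:
  assumes "f \<in> Arr C" "g \<in> Arr C" "Dom C g = Cod C f"
  shows "neg g \<cdot> f = neg (g \<cdot> f)" "g \<cdot> neg f = neg (g \<cdot> f)"
proof -
  have "neg g \<cdot> f \<oplus> g \<cdot> f = neg (g \<cdot> f) \<oplus> g \<cdot> f"
    by (subst Comp_Add_distrib[symmetric]) (use assms in simp_all)
  then show "neg g \<cdot> f = neg (g \<cdot> f)" by (rule Add_right_imp_eq) (use assms in simp_all)
  have "g \<cdot> neg f \<oplus> g \<cdot> f = neg (g \<cdot> f) \<oplus> g \<cdot> f"
    by (subst Comp_Add_distrib2[symmetric]) (use assms in simp_all)
  then show "g \<cdot> neg f = neg (g \<cdot> f)" by (rule Add_right_imp_eq) (use assms in simp_all)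
qed

text \<open>Testing against zero morphisms suffices, because Hom sets are groups and composition is
  additive.\<close>

lemma monic_iff_cancel_zero:
  "monic C f \<longleftrightarrow> f \<in> Arr C \<and> (\<forall>u\<in>Arr C. Cod C u = Dom C f \<longrightarrow>
    f \<cdot> u = Zero C (Dom C u) (Cod C f) \<longrightarrow> u = Zero C (Dom C u) (Dom C f))"
proof (intro iffI conjI ballI impI; (elim conjE)?)
  fix u assume f: "monic C f" and u: "u \<in> Arr C" "Cod C u = Dom C f"
    "f \<cdot> u = Zero C (Dom C u) (Cod C f)"
  have f': "f \<in> Arr C" using f by (simp add: monic_def)
  show "u = Zero C (Dom C u) (Dom C f)"
    by (rule monicD[OF f]) (use u f' in simp_all)
next
  assume f: "f \<in> Arr C" and *: "\<forall>u\<in>Arr C. Cod C u = Dom C f \<longrightarrow>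
    f \<cdot> u = Zero C (Dom C u) (Cod C f) \<longrightarrow> u = Zero C (Dom C u) (Dom C f)"
  show "monic C f"
    unfolding monic_def
  proof (intro conjI ballI impI)
    fix X u v assume "u \<in> Hom C X (Dom C f)" "v \<in> Hom C X (Dom C f)" and eq: "f \<cdot> u = f \<cdot> v"
    then have u: "u \<in> Arr C" "Cod C u = Dom C f" and v: "v \<in> Arr C" "Cod C v = Dom C f"
        "Dom C v = Dom C u"
      by (auto simp: Hom_iff)
    have "f \<cdot> (u \<oplus> neg v) = Zero C (Dom C u) (Cod C f)" using u v f eq by simp
    then have "u \<oplus> neg v = Zero C (Dom C u) (Dom C f)"
      using *[rule_format, of "u \<oplus> neg v"] u v by simp
    then show "u = v" using eq_iff_diff_zero u v by simp
  qed (rule f)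
qed (simp add: monic_def)

lemma monic_zeroD:
  assumes "monic C f" "f \<cdot> u = Zero C (Dom C u) (Cod C f)" "u \<in> Arr C" "Cod C u = Dom C f"
  shows "u = Zero C (Dom C u) (Dom C f)"
  using assms unfolding monic_iff_cancel_zero by blast

end

section \<open>Duality\<close>

text \<open>The opposite category is used to halve the work: a statement about kernels, subobjects or
  precovers is proved once, and its dual is the same statement for \<open>op_cat C\<close>, translated
  back by the simplification rules of this section.\<close>

lemma op_cat_simps [simp]:
  "Obj (op_cat C) = Obj C" "Arr (op_cat C) = Arr C" "Dom (op_cat C) = Cod C"
  "Cod (op_cat C) = Dom C" "Id (op_cat C) = Id C" "g \<cdot>\<^bsub>op_cat C\<^esub> f = f \<cdot>\<^bsub>C\<^esub> g"
  "Add (op_cat C) = Add C" "Zero (op_cat C) M N = Zero C N M"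
  by (simp_all add: op_cat_def)

lemma op_op_cat [simp]: "op_cat (op_cat C) = C"
  by (simp add: op_cat_def)

lemma Hom_op_cat [simp]: "Hom (op_cat C) M N = Hom C N M"
  by (auto simp: Hom_def)

lemma monic_op_cat [simp]: "monic (op_cat C) = epic C"
  by (simp add: monic_def epic_def fun_eq_iff)

lemma epic_op_cat [simp]: "epic (op_cat C) = monic C"
  by (simp add: monic_def epic_def fun_eq_iff)

lemma is_isom_op_cat [simp]: "is_isom (op_cat C) = is_isom C"
  by (auto simp: is_isom_def fun_eq_iff)

lemma is_kernel_op_cat [simp]: "is_kernel (op_cat C) k f \<longleftrightarrow> is_cokernel C f k"
  by (auto simp: is_kernel_def is_cokernel_def)

lemma is_cokernel_op_cat [simp]: "is_cokernel (op_cat C) f q \<longleftrightarrow> is_kernel C q f"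
  by (auto simp: is_kernel_def is_cokernel_def)

lemma zero_object_op_cat [simp]: "zero_object (op_cat C) = zero_object C"
  by (auto simp: zero_object_def fun_eq_iff)

lemma is_coproduct_op_cat [simp]: "is_coproduct (op_cat C) = is_product C"
  by (simp add: is_coproduct_def is_product_def fun_eq_iff)

lemma is_product_op_cat [simp]: "is_product (op_cat C) = is_coproduct C"
  by (simp add: is_coproduct_def is_product_def fun_eq_iff)

locale abelian = abelian_category C for C :: "('o, 'm) additive_cat" (structure)

lemma (in abelian) abelian_op_cat: "abelian (op_cat C)"
proof (intro abelian.intro abelian_category.intro abelian_category_axioms.intro
    preadditive_category.intro preadditive_category_axioms.intro category.intro)
  fix K L M N f f' g g' h X Y
  show "f \<in> Arr (op_cat C) \<Longrightarrow> Dom (op_cat C) f \<in> Obj (op_cat C)"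
    and "f \<in> Arr (op_cat C) \<Longrightarrow> Cod (op_cat C) f \<in> Obj (op_cat C)"
    and "M \<in> Obj (op_cat C) \<Longrightarrow> Id (op_cat C) M \<in> Hom (op_cat C) M M"
    by (simp_all add: Hom_iff)
  show "f \<in> Hom (op_cat C) L M \<Longrightarrow> g \<in> Hom (op_cat C) M N \<Longrightarrow>
      g \<cdot>\<^bsub>op_cat C\<^esub> f \<in> Hom (op_cat C) L N"
    and "f \<in> Hom (op_cat C) M N \<Longrightarrow> f \<cdot>\<^bsub>op_cat C\<^esub> Id (op_cat C) M = f"
    and "f \<in> Hom (op_cat C) M N \<Longrightarrow> Id (op_cat C) N \<cdot>\<^bsub>op_cat C\<^esub> f = f"
    by (auto simp: Hom_iff)
  show "f \<in> Hom (op_cat C) K L \<Longrightarrow> g \<in> Hom (op_cat C) L M \<Longrightarrow> h \<in> Hom (op_cat C) M N \<Longrightarrow>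
      h \<cdot>\<^bsub>op_cat C\<^esub> (g \<cdot>\<^bsub>op_cat C\<^esub> f) = (h \<cdot>\<^bsub>op_cat C\<^esub> g) \<cdot>\<^bsub>op_cat C\<^esub> f"
    by (auto simp: Hom_iff)
  show "f \<in> Hom (op_cat C) L M \<Longrightarrow> g \<in> Hom (op_cat C) M N \<Longrightarrow> g' \<in> Hom (op_cat C) M N \<Longrightarrow>
      Add (op_cat C) g g' \<cdot>\<^bsub>op_cat C\<^esub> f =
      Add (op_cat C) (g \<cdot>\<^bsub>op_cat C\<^esub> f) (g' \<cdot>\<^bsub>op_cat C\<^esub> f)"
    by (auto simp: Hom_iff)
  show "f \<in> Hom (op_cat C) L M \<Longrightarrow> f' \<in> Hom (op_cat C) L M \<Longrightarrow> g \<in> Hom (op_cat C) M N \<Longrightarrow>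
      g \<cdot>\<^bsub>op_cat C\<^esub> Add (op_cat C) f f' =
      Add (op_cat C) (g \<cdot>\<^bsub>op_cat C\<^esub> f) (g \<cdot>\<^bsub>op_cat C\<^esub> f')"
    by (auto simp: Hom_iff)
  show "M \<in> Obj (op_cat C) \<Longrightarrow> N \<in> Obj (op_cat C) \<Longrightarrow> comm_group (hom_group (op_cat C) M N)"
    by (simp add: Hom_comm_group)
  show "\<exists>Z. zero_object (op_cat C) Z" by (simp add: ex_zero_object)
  show "X \<in> Obj (op_cat C) \<Longrightarrow> Y \<in> Obj (op_cat C) \<Longrightarrow> \<exists>M a b. is_coproduct (op_cat C) X Y M a b"
    and "X \<in> Obj (op_cat C) \<Longrightarrow> Y \<in> Obj (op_cat C) \<Longrightarrow> \<exists>M p q. is_product (op_cat C) X Y M p q"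
    by (simp_all add: ex_coproduct ex_product)
  show "f \<in> Arr (op_cat C) \<Longrightarrow> \<exists>k. is_kernel (op_cat C) k f"
    and "f \<in> Arr (op_cat C) \<Longrightarrow> \<exists>q. is_cokernel (op_cat C) f q"
    by (simp_all add: ex_kernel ex_cokernel)
  show "monic (op_cat C) f \<Longrightarrow> \<exists>g. is_kernel (op_cat C) f g"
    and "epic (op_cat C) f \<Longrightarrow> \<exists>g. is_cokernel (op_cat C) g f"
    by (simp_all add: monic_is_kernel epic_is_cokernel)
qed

section \<open>Kernels, cokernels and images in an abelian category\<close>

context abelian
begin

lemma is_kernelD:
  assumes "is_kernel C k f"
  shows "k \<in> Arr C" "f \<in> Arr C" "Cod C k = Dom C f" "f \<cdot> k = Zero C (Dom C k) (Cod C f)"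
  using assms by (auto simp: is_kernel_def)

lemma is_cokernelD:
  assumes "is_cokernel C f q"
  shows "q \<in> Arr C" "f \<in> Arr C" "Dom C q = Cod C f" "q \<cdot> f = Zero C (Dom C f) (Cod C q)"
  using assms by (auto simp: is_cokernel_def)

lemma kernel_factor:
  assumes "is_kernel C k f" "u \<in> Arr C" "Cod C u = Dom C f" "f \<cdot> u = Zero C (Dom C u) (Cod C f)"
  obtains w where "w \<in> Arr C" "Dom C w = Dom C u" "Cod C w = Dom C k" "k \<cdot> w = u"
proof -
  have "u \<in> Hom C (Dom C u) (Dom C f)" "Dom C u \<in> Obj C" using assms by (auto simp: Hom_iff)
  then show thesis using assms(1,4) that unfolding is_kernel_def by (metis Hom_iff)
qed

lemma cokernel_factor:
  assumes "is_cokernel C f q" "u \<in> Arr C" "Dom C u = Cod C f" "u \<cdot> f = Zero C (Dom C f) (Cod C u)"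
  obtains w where "w \<in> Arr C" "Cod C w = Cod C u" "Dom C w = Cod C q" "w \<cdot> q = u"
proof -
  interpret op: abelian "op_cat C" by (rule abelian_op_cat)
  show thesis using op.kernel_factor[of q f u thesis] assms that by simp
qed

lemma kernel_monic:
  assumes "is_kernel C k f"
  shows "monic C k"
  unfolding monic_def
proof (intro conjI ballI impI)
  note k = is_kernelD[OF assms]
  show "k \<in> Arr C" by (rule k)
  fix X u v assume X: "X \<in> Obj C" and uv: "u \<in> Hom C X (Dom C k)" "v \<in> Hom C X (Dom C k)"
    and eq: "k \<cdot> u = k \<cdot> v"
  have "f \<cdot> (k \<cdot> v) = Zero C X (Cod C f)"
    using Comp_extend[OF k(4), of v] uv k by (auto simp: Hom_iff)
  moreover have "k \<cdot> v \<in> Hom C X (Dom C f)" using uv k by (auto simp: Hom_iff)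
  ultimately have "\<exists>!w. w \<in> Hom C X (Dom C k) \<and> k \<cdot> w = k \<cdot> v"
    using assms X unfolding is_kernel_def by blast
  then show "u = v" using uv eq by blast
qed

lemma cokernel_epic:
  assumes "is_cokernel C f q"
  shows "epic C q"
  using abelian.kernel_monic[OF abelian_op_cat, of q f] assms by simp

text \<open>Uniqueness of the factorization, which is part of being a kernel, comes from monicity.\<close>

lemma is_kernelI:
  assumes "monic C k" "f \<in> Arr C" "Cod C k = Dom C f" "f \<cdot> k = Zero C (Dom C k) (Cod C f)"
    and "\<And>u. u \<in> Arr C \<Longrightarrow> Cod C u = Dom C f \<Longrightarrow> f \<cdot> u = Zero C (Dom C u) (Cod C f) \<Longrightarrow>
      \<exists>w. w \<in> Arr C \<and> Dom C w = Dom C u \<and> Cod C w = Dom C k \<and> k \<cdot> w = u"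
  shows "is_kernel C k f"
  unfolding is_kernel_def
proof (intro conjI ballI impI)
  show k: "k \<in> Arr C" using assms(1) by (simp add: monic_def)
  fix X u assume X: "X \<in> Obj C" "u \<in> Hom C X (Dom C f)" "f \<cdot> u = Zero C X (Cod C f)"
  then obtain w where w: "w \<in> Hom C X (Dom C k)" "k \<cdot> w = u"
    using assms(5)[of u] by (auto simp: Hom_iff)
  then show "\<exists>!w. w \<in> Hom C X (Dom C k) \<and> k \<cdot> w = u"
    using monicD[OF assms(1)] by (auto simp: Hom_iff intro!: ex1I[of _ w])
qed (use assms in auto)

lemma monic_is_kernel_of_cokernel:
  assumes "monic C m" "is_cokernel C m c"
  shows "is_kernel C m c"
proof -
  obtain h where h: "is_kernel C m h" using monic_is_kernel assms(1) by blast
  note m = is_kernelD[OF h] and c = is_cokernelD[OF assms(2)]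
  obtain h' where h': "h' \<in> Arr C" "Cod C h' = Cod C h" "Dom C h' = Cod C c" "h' \<cdot> c = h"
    using cokernel_factor[OF assms(2), of h] m by auto
  show ?thesis
  proof (rule is_kernelI[OF assms(1)])
    fix u assume u: "u \<in> Arr C" "Cod C u = Dom C c" "c \<cdot> u = Zero C (Dom C u) (Cod C c)"
    have "h \<cdot> u = Zero C (Dom C u) (Cod C h)"
      using Comp_extend[OF h'(4), of u] h'(1-3) u c by simp
    then show "\<exists>w. w \<in> Arr C \<and> Dom C w = Dom C u \<and> Cod C w = Dom C m \<and> m \<cdot> w = u"
      using kernel_factor[OF h, of u] u c m by metis
  qed (use c in auto)
qed

lemma epic_is_cokernel_of_kernel:
  assumes "epic C e" "is_kernel C k e"
  shows "is_cokernel C k e"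
  using abelian.monic_is_kernel_of_cokernel[OF abelian_op_cat, of e k] assms by simp

text \<open>The kernel \<open>m\<close> of a cokernel of \<open>f\<close> is the image of \<open>f\<close>. The induced morphism \<open>e\<close>
  is epic because \<open>m\<close> is the smallest subobject through which \<open>f\<close> factors: if \<open>z \<cdot> e = 0\<close>
  then \<open>f\<close> factors through the subobject \<open>m \<cdot> ker z\<close>, which must therefore be all of \<open>m\<close>.\<close>

lemma image_factorization:
  assumes c: "is_cokernel C f c" and m: "is_kernel C m c"
  obtains e where "epic C e" "e \<in> Arr C" "Dom C e = Dom C f" "Cod C e = Dom C m" "m \<cdot> e = f"
proof -
  interpret op: abelian "op_cat C" by (rule abelian_op_cat)
  note c' = is_cokernelD[OF c] and m' = is_kernelD[OF m] and mono = kernel_monic[OF m]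
  obtain e where e: "e \<in> Arr C" "Dom C e = Dom C f" "Cod C e = Dom C m" "m \<cdot> e = f"
    using kernel_factor[OF m, of f] c' by auto
  have "epic C e"
    unfolding monic_op_cat[symmetric] op.monic_iff_cancel_zero op_cat_simps
  proof (intro conjI ballI impI)
    fix z assume z: "z \<in> Arr C" "Dom C z = Cod C e" "z \<cdot> e = Zero C (Dom C e) (Cod C z)"
    obtain n where n: "is_kernel C n z" using ex_kernel z(1) by blast
    note n' = is_kernelD[OF n]
    obtain e' where e': "e' \<in> Arr C" "Dom C e' = Dom C e" "Cod C e' = Dom C n" "n \<cdot> e' = e"
      using kernel_factor[OF n, of e] z e by auto
    \<comment> \<open>monic, hence a kernel of some \<open>h\<close>; as \<open>h\<close> kills \<open>f\<close> it factors through \<open>c\<close> and kills \<open>m\<close>\<close>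
    have "monic C (m \<cdot> n)"
      unfolding monic_iff_cancel_zero
    proof (intro conjI ballI impI)
      fix u assume u: "u \<in> Arr C" "Cod C u = Dom C (m \<cdot> n)"
        "(m \<cdot> n) \<cdot> u = Zero C (Dom C u) (Cod C (m \<cdot> n))"
      then have "n \<cdot> u = Zero C (Dom C u) (Dom C m)"
        using monic_zeroD[OF mono, of "n \<cdot> u"] m' n' z e by simp
      then show "u = Zero C (Dom C u) (Dom C (m \<cdot> n))"
        using monic_zeroD[OF kernel_monic[OF n], of u] u m' n' z e by simp
    qed (use m' n' z e in simp)
    then obtain h where h: "is_kernel C (m \<cdot> n) h" using monic_is_kernel by blast
    note h' = is_kernelD[OF h]
    have hd: "Dom C h = Cod C m" using h' m' n' z e by simp
    have "m \<cdot> (n \<cdot> e') = f" using e e' by simp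
    then have "h \<cdot> f = (h \<cdot> (m \<cdot> n)) \<cdot> e'"
      using e(1-3) e'(1-3) m'(1-3) n'(1-3) hd h'(2) z(1,2) by simp
    also have "\<dots> = Zero C (Dom C f) (Cod C h)"
      unfolding h'(4) using h'(2) m' n' hd z e e' by simp
    finally obtain h1 where h1: "h1 \<in> Arr C" "Cod C h1 = Cod C h" "Dom C h1 = Cod C c" "h1 \<cdot> c = h"
      using cokernel_factor[OF c, of h] h' hd m' c' by metis
    have "h \<cdot> m = Zero C (Dom C m) (Cod C h)"
      using Comp_extend[OF h1(4), of m] h1(1-3) m' c' by simp
    then obtain w where w: "w \<in> Arr C" "Dom C w = Dom C m" "Cod C w = Dom C (m \<cdot> n)"
      "(m \<cdot> n) \<cdot> w = m"
      using kernel_factor[OF h, of m] m' hd by metis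
    have w1: "Cod C w = Dom C n" using w m' n' z e by simp
    have "m \<cdot> (n \<cdot> w) = m \<cdot> Id C (Dom C m)" using w w1 m' n' z e by simp
    then have nw: "n \<cdot> w = Id C (Dom C m)"
      by (rule monicD[OF mono]) (use w w1 m' n' z e in simp_all)
    have "z = z \<cdot> (n \<cdot> w)" using nw z e by simp
    also have "\<dots> = Zero C (Cod C e) (Cod C z)"
      using Comp_extend[OF n'(4), of w] w w1 m' n' z e by simp
    finally show "z = Zero C (Cod C e) (Cod C z)" .
  qed (rule e)
  then show thesis using that e by blast
qed

lemma coimage_factorization:
  assumes "is_kernel C k f" "is_cokernel C k c"
  obtains m where "monic C m" "m \<in> Arr C" "Cod C m = Cod C f" "Dom C m = Cod C c" "m \<cdot> c = f"
proof -
  interpret op: abelian "op_cat C" by (rule abelian_op_cat)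
  show thesis using op.image_factorization[of f k c thesis] assms that by simp
qed

lemma monic_epic_is_isom:
  assumes "monic C f" "epic C f"
  shows "is_isom C f"
proof -
  obtain h where h: "is_kernel C f h" using monic_is_kernel assms(1) by blast
  note f = is_kernelD[OF h]
  have "h \<cdot> f = Zero C (Cod C f) (Cod C h) \<cdot> f" using f by simp
  then have "h = Zero C (Cod C f) (Cod C h)"
    by (rule epicD[OF assms(2)]) (use f in simp_all)
  then have "h \<cdot> Id C (Cod C f) = Zero C (Cod C f) (Cod C h)"
    using f Comp_Id_simps(1)[of h "Cod C f"] by simp
  then obtain g where g: "g \<in> Arr C" "Dom C g = Cod C f" "Cod C g = Dom C f"
    "f \<cdot> g = Id C (Cod C f)"
    using kernel_factor[OF h, of "Id C (Cod C f)"] f by auto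
  have "f \<cdot> (g \<cdot> f) = f \<cdot> Id C (Dom C f)" using g f Comp_extend[OF g(4), of f] by simp
  then have "g \<cdot> f = Id C (Dom C f)"
    by (rule monicD[OF assms(1)]) (use f g in simp_all)
  then show ?thesis using f g unfolding is_isom_def by (auto simp: Hom_iff intro!: bexI[of _ g])
qed

lemma coproduct_projections:
  assumes "is_coproduct C X Y S a b" "X \<in> Obj C" "Y \<in> Obj C"
  obtains p q where "p \<in> Hom C S X" "q \<in> Hom C S Y"
    "p \<cdot> a = Id C X" "q \<cdot> b = Id C Y" "p \<cdot> b = Zero C Y X" "q \<cdot> a = Zero C X Y"
    "a \<cdot> p \<oplus> b \<cdot> q = Id C S"
proof -
  have a: "a \<in> Hom C X S" and b: "b \<in> Hom C Y S"
    and univ: "\<And>Z u v. Z \<in> Obj C \<Longrightarrow> u \<in> Hom C X Z \<Longrightarrow> v \<in> Hom C Y Z \<Longrightarrow>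
      \<exists>!w. w \<in> Hom C S Z \<and> w \<cdot> a = u \<and> w \<cdot> b = v"
    using assms(1) unfolding is_coproduct_def by auto
  obtain p where p: "p \<in> Hom C S X" "p \<cdot> a = Id C X" "p \<cdot> b = Zero C Y X"
    using univ[of X "Id C X" "Zero C Y X"] assms by (auto simp: Hom_iff)
  obtain q where q: "q \<in> Hom C S Y" "q \<cdot> a = Zero C X Y" "q \<cdot> b = Id C Y"
    using univ[of Y "Zero C X Y" "Id C Y"] assms by (auto simp: Hom_iff)
  have S: "S \<in> Obj C" using a by (auto simp: Hom_iff)
  have "a \<cdot> p \<oplus> b \<cdot> q = Id C S"
  proof -
    have "a \<cdot> p \<oplus> b \<cdot> q \<in> Hom C S S \<and> (a \<cdot> p \<oplus> b \<cdot> q) \<cdot> a = a \<and> (a \<cdot> p \<oplus> b \<cdot> q) \<cdot> b = b"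
      using a b p q assms(2,3) S by (auto simp: Hom_iff)
    moreover have "Id C S \<in> Hom C S S \<and> Id C S \<cdot> a = a \<and> Id C S \<cdot> b = b"
      using a b S by (auto simp: Hom_iff)
    ultimately show ?thesis using univ[OF S a b] by blast
  qed
  then show thesis using that p q by blast
qed

lemma ex_biproduct:
  assumes "X \<in> Obj C" "Y \<in> Obj C"
  obtains S a b p q where "a \<in> Hom C X S" "b \<in> Hom C Y S" "p \<in> Hom C S X" "q \<in> Hom C S Y"
    "p \<cdot> a = Id C X" "q \<cdot> b = Id C Y" "p \<cdot> b = Zero C Y X" "q \<cdot> a = Zero C X Y"
    "a \<cdot> p \<oplus> b \<cdot> q = Id C S" "is_coproduct C X Y S a b"
proof -
  obtain S a b where ab: "is_coproduct C X Y S a b" using ex_coproduct assms by blast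
  then have "a \<in> Hom C X S" "b \<in> Hom C Y S" unfolding is_coproduct_def by auto
  moreover obtain p q where "p \<in> Hom C S X" "q \<in> Hom C S Y" "p \<cdot> a = Id C X" "q \<cdot> b = Id C Y"
    "p \<cdot> b = Zero C Y X" "q \<cdot> a = Zero C X Y" "a \<cdot> p \<oplus> b \<cdot> q = Id C S"
    using coproduct_projections[OF ab assms] .
  ultimately show thesis using that ab by blast
qed

text \<open>The pushout is the cokernel of \<open>a \<cdot> i - b \<cdot> f\<close>, where \<open>a\<close> and \<open>b\<close> are the injections
  into the coproduct of the two codomains.\<close>

lemma ex_pushout:
  assumes "i \<in> Arr C" "f \<in> Arr C" "Dom C i = Dom C f"
  obtains t g where "is_pushout C i f t g"
proof -
  obtain S a b p r where ab: "a \<in> Hom C (Cod C i) S" "b \<in> Hom C (Cod C f) S"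
      "p \<in> Hom C S (Cod C i)" "r \<in> Hom C S (Cod C f)"
    and id: "a \<cdot> p \<oplus> b \<cdot> r = Id C S" and "is_coproduct C (Cod C i) (Cod C f) S a b"
    using ex_biproduct[of "Cod C i" "Cod C f"] assms by (metis Cod_Obj)
  then have univ: "\<And>Z u v. Z \<in> Obj C \<Longrightarrow> u \<in> Hom C (Cod C i) Z \<Longrightarrow> v \<in> Hom C (Cod C f) Z \<Longrightarrow>
      \<exists>!w. w \<in> Hom C S Z \<and> w \<cdot> a = u \<and> w \<cdot> b = v"
    unfolding is_coproduct_def by auto
  note ab' = ab[unfolded Hom_iff]
  let ?d = "a \<cdot> i \<oplus> neg (b \<cdot> f)"
  have d: "?d \<in> Arr C" "Dom C ?d = Dom C f" "Cod C ?d = S" using ab' assms by auto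
  then obtain c where c: "is_cokernel C ?d c" using ex_cokernel by blast
  note c' = is_cokernelD[OF c]
  have "(c \<cdot> a) \<cdot> i \<oplus> neg ((c \<cdot> b) \<cdot> f) = Zero C (Dom C f) (Cod C c)"
    using c' d ab' assms by simp
  then have comm: "(c \<cdot> a) \<cdot> i = (c \<cdot> b) \<cdot> f"
    by (subst eq_iff_diff_zero) (use c' d ab' assms in simp_all)
  have "is_pushout C i f (c \<cdot> a) (c \<cdot> b)"
    unfolding is_pushout_def
  proof (intro conjI ballI impI)
    fix X u v assume X: "X \<in> Obj C" and u: "u \<in> Hom C (Cod C i) X" and v: "v \<in> Hom C (Cod C f) X"
      and uv: "u \<cdot> i = v \<cdot> f"
    note u' = u[unfolded Hom_iff] and v' = v[unfolded Hom_iff]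
    obtain x where x: "x \<in> Hom C S X" "x \<cdot> a = u" "x \<cdot> b = v" using univ[OF X u v] by blast
    note x' = x(1)[unfolded Hom_iff]
    have "x \<cdot> ?d = (x \<cdot> a) \<cdot> i \<oplus> neg ((x \<cdot> b) \<cdot> f)" using x' ab' assms by simp
    also have "\<dots> = Zero C (Dom C f) X" using uv u' v' assms by (simp add: x)
    finally obtain w where w: "w \<in> Arr C" "Cod C w = Cod C x" "Dom C w = Cod C c" "w \<cdot> c = x"
      using cokernel_factor[OF c, of x] x' d by metis
    show "\<exists>!w. w \<in> Hom C (Cod C (c \<cdot> a)) X \<and> w \<cdot> (c \<cdot> a) = u \<and> w \<cdot> (c \<cdot> b) = v"
    proof (rule ex1I[of _ w])
      show "w \<in> Hom C (Cod C (c \<cdot> a)) X \<and> w \<cdot> (c \<cdot> a) = u \<and> w \<cdot> (c \<cdot> b) = v"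
        using w x x' c' d ab' by (auto simp: Hom_iff Comp_extend[OF w(4)])
      fix w' assume w': "w' \<in> Hom C (Cod C (c \<cdot> a)) X \<and> w' \<cdot> (c \<cdot> a) = u \<and> w' \<cdot> (c \<cdot> b) = v"
      then have w'': "w' \<in> Arr C" "Dom C w' = Cod C c" "Cod C w' = X"
        using c' d ab' by (auto simp: Hom_iff)
      have "w' \<cdot> c \<in> Hom C S X" "(w' \<cdot> c) \<cdot> a = u" "(w' \<cdot> c) \<cdot> b = v"
        using w' w'' c' d ab' by (auto simp: Hom_iff)
      then have w'x: "w' \<cdot> c = x" using univ[OF X u v] x by blast
      show "w' = w"
        by (rule epicD[OF cokernel_epic[OF c]]) (use w'x w w'' c' x' in simp_all)
    qed
  qed (use comm c' d ab' assms in \<open>auto simp: Hom_iff\<close>)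
  then show thesis using that by blast
qed

end

section \<open>Serre classes and small morphisms\<close>

lemma short_exact_op_cat [simp]: "short_exact (op_cat C) f g \<longleftrightarrow> short_exact C g f"
  by (auto simp: short_exact_def)

lemma factors_through_op_cat [simp]: "factors_through (op_cat C) \<T> = factors_through C \<T>"
  unfolding factors_through_def by (auto simp: fun_eq_iff)

lemma serre_class_op_cat [simp]: "serre_class (op_cat C) \<T> \<longleftrightarrow> serre_class C \<T>"
  unfolding serre_class_def op_cat_simps Hom_op_cat short_exact_op_cat
  by (intro arg_cong2[of _ _ _ _ "(\<and>)"]) blast+

text \<open>The empty set of objects satisfies the definition of a Serre class. It is excluded here because a
  nonempty Serre class contains the zero objects, so that zero morphisms factor through it and
  stable classes are genuine cosets.\<close>

locale serre = abelian C for C :: "('o, 'm) additive_cat" (structure) +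
  fixes \<T> :: "'o set"
  assumes serre_class: "serre_class C \<T>" and nonempty: "\<T> \<noteq> {}"
begin

lemma serre_op_cat: "serre (op_cat C) \<T>"
  using abelian_op_cat serre_class nonempty by (simp add: serre_def serre_axioms_def)

lemma T_Obj [simp]: "T \<in> \<T> \<Longrightarrow> T \<in> Obj C"
  using serre_class by (auto simp: serre_class_def)

lemma T_short_exact:
  assumes "is_kernel C f g" "is_cokernel C f g"
  shows "Cod C f \<in> \<T> \<longleftrightarrow> Dom C f \<in> \<T> \<and> Cod C g \<in> \<T>"
proof -
  have "f \<in> Hom C (Dom C f) (Cod C f)" "g \<in> Hom C (Cod C f) (Cod C g)"
    using is_kernelD[OF assms(1)] by (auto simp: Hom_iff)
  then show ?thesis
    using serre_class assms unfolding serre_class_def short_exact_def by blast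
qed

lemma T_subobject:
  assumes "monic C m" "Cod C m \<in> \<T>"
  shows "Dom C m \<in> \<T>"
proof -
  obtain c where c: "is_cokernel C m c" using ex_cokernel[OF monic_Arr[OF assms(1)]] by blast
  show ?thesis using T_short_exact[OF monic_is_kernel_of_cokernel[OF assms(1) c] c] assms(2) by simp
qed

lemma T_quotient:
  assumes "epic C e" "Dom C e \<in> \<T>"
  shows "Cod C e \<in> \<T>"
  using serre.T_subobject[OF serre_op_cat, of e] assms by simp

text \<open>A form of closure under extensions without a short exact sequence: the image of \<open>f\<close> is a
  subobject of an object of \<open>\<T>\<close>, and the domain of \<open>f\<close> is an extension of it by the
  kernel.\<close>

lemma T_extension:
  assumes "is_kernel C k f" "Dom C k \<in> \<T>" "Cod C f \<in> \<T>"
  shows "Dom C f \<in> \<T>"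
proof -
  note k = is_kernelD[OF assms(1)]
  obtain c where c: "is_cokernel C k c" using ex_cokernel k by blast
  note c' = is_cokernelD[OF c]
  obtain m where m: "monic C m" "Cod C m = Cod C f" "Dom C m = Cod C c"
    using coimage_factorization[OF assms(1) c] .
  have "Cod C c \<in> \<T>" using T_subobject[OF m(1)] m assms(3) by simp
  moreover have "is_kernel C k c"
    by (rule monic_is_kernel_of_cokernel[OF kernel_monic[OF assms(1)] c])
  ultimately show ?thesis using T_short_exact[of k c] c assms(2) k by simp
qed

text \<open>An object with zero identity is a subobject of any object whatsoever.\<close>

lemma T_of_Id_eq_Zero:
  assumes "M \<in> Obj C" "Id C M = Zero C M M"
  shows "M \<in> \<T>"
proof -
  obtain T where T: "T \<in> \<T>" using nonempty by blast
  have "monic C (Zero C M T)"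
    unfolding monic_iff_cancel_zero
  proof (intro conjI ballI impI)
    fix u assume u: "u \<in> Arr C" "Cod C u = Dom C (Zero C M T)"
    have u': "Cod C u = M" using u(2) assms(1) T by simp
    have "Id C M \<cdot> u = Zero C M M \<cdot> u" by (simp only: assms(2))
    then show "u = Zero C (Dom C u) (Dom C (Zero C M T))" using u(1) u' assms(1) T by simp
  qed (use assms T in auto)
  then show ?thesis using T_subobject[of "Zero C M T"] assms T by simp
qed

text \<open>The small morphisms are those that become zero in the stable category. They form a two-sided
  ideal; only closure under sums needs an argument, namely that \<open>\<T>\<close> is closed under
  biproducts.\<close>

abbreviation small :: "'m \<Rightarrow> bool" where "small \<equiv> factors_through C \<T>"

lemma smallI:
  assumes "u \<in> Arr C" "v \<in> Arr C" "Dom C v = Cod C u" "Cod C u \<in> \<T>"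
  shows "small (v \<cdot> u)"
  unfolding factors_through_def
  by (intro bexI[of _ "Cod C u"] bexI[of _ u] bexI[of _ v]) (use assms in \<open>simp_all add: Hom_iff\<close>)

lemma smallE:
  assumes "small f" "f \<in> Arr C"
  obtains u v where "u \<in> Arr C" "v \<in> Arr C" "Dom C u = Dom C f" "Cod C v = Cod C f"
    "Dom C v = Cod C u" "Cod C u \<in> \<T>" "v \<cdot> u = f"
proof -
  obtain T u v where "T \<in> \<T>" "u \<in> Hom C (Dom C f) T" "v \<in> Hom C T (Cod C f)" "v \<cdot> u = f"
    using assms(1) unfolding factors_through_def by blast
  then show thesis using that[of u v] by (simp add: Hom_iff)
qed

lemma small_Dom: "f \<in> Arr C \<Longrightarrow> Dom C f \<in> \<T> \<Longrightarrow> small f"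
  using smallI[of "Id C (Dom C f)" f] by simp

lemma small_Cod: "f \<in> Arr C \<Longrightarrow> Cod C f \<in> \<T> \<Longrightarrow> small f"
  using smallI[of f "Id C (Cod C f)"] by simp

lemma small_Zero:
  assumes "M \<in> Obj C" "N \<in> Obj C"
  shows "small (Zero C M N)"
proof -
  obtain T where "T \<in> \<T>" using nonempty by blast
  then show ?thesis using smallI[of "Zero C M T" "Zero C T N"] assms by simp
qed

lemma small_Comp_left:
  assumes "small f" "f \<in> Arr C" "g \<in> Arr C" "Dom C g = Cod C f"
  shows "small (g \<cdot> f)"
proof -
  obtain u v where uv: "u \<in> Arr C" "v \<in> Arr C" "Dom C u = Dom C f" "Cod C v = Cod C f"
    "Dom C v = Cod C u" "Cod C u \<in> \<T>" "v \<cdot> u = f" using smallE assms(1,2) .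
  then show ?thesis using smallI[of u "g \<cdot> v"] assms by simp
qed

lemma small_Comp_right:
  assumes "small g" "f \<in> Arr C" "g \<in> Arr C" "Dom C g = Cod C f"
  shows "small (g \<cdot> f)"
  using serre.small_Comp_left[OF serre_op_cat, of g f] assms by simp

lemma small_neg:
  assumes "small f" "f \<in> Arr C"
  shows "small (neg f)"
  using small_Comp_left[of f "neg (Id C (Cod C f))"] assms by simp

lemma T_biproduct:
  assumes "X \<in> \<T>" "Y \<in> \<T>" "a \<in> Hom C X S" "b \<in> Hom C Y S" "p \<in> Hom C S X" "q \<in> Hom C S Y"
    "a \<cdot> p \<oplus> b \<cdot> q = Id C S"
  shows "S \<in> \<T>"
proof -
  note h = assms(3-6)[unfolded Hom_iff]
  obtain k where k: "is_kernel C k q" using ex_kernel h by blast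
  note k' = is_kernelD[OF k]
  have "k = (a \<cdot> p \<oplus> b \<cdot> q) \<cdot> k" using assms(7) k' h by simp
  also have "\<dots> = a \<cdot> (p \<cdot> k)" using k' h assms(1,2) by simp
  finally have k_eq: "k = a \<cdot> (p \<cdot> k)" .
  have "monic C (p \<cdot> k)"
    unfolding monic_iff_cancel_zero
  proof (intro conjI ballI impI)
    fix u assume u: "u \<in> Arr C" "Cod C u = Dom C (p \<cdot> k)"
      "(p \<cdot> k) \<cdot> u = Zero C (Dom C u) (Cod C (p \<cdot> k))"
    have "k \<cdot> u = (a \<cdot> (p \<cdot> k)) \<cdot> u" using k_eq by simp
    also have "\<dots> = Zero C (Dom C u) (Cod C k)" using u k' h by simp
    finally show "u = Zero C (Dom C u) (Dom C (p \<cdot> k))"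
      using monic_zeroD[OF kernel_monic[OF k], of u] u k' h by simp
  qed (use k' h in auto)
  then have "Dom C k \<in> \<T>" using T_subobject[of "p \<cdot> k"] k' h assms(1) by simp
  then show ?thesis using T_extension[OF k] h assms(2) by simp
qed

lemma small_Add:
  assumes "small f" "small g" "f \<in> Arr C" "g \<in> Arr C" "Dom C g = Dom C f" "Cod C g = Cod C f"
  shows "small (f \<oplus> g)"
proof -
  obtain u v where uv: "u \<in> Arr C" "v \<in> Arr C" "Dom C u = Dom C f" "Cod C v = Cod C f"
    "Dom C v = Cod C u" "Cod C u \<in> \<T>" "v \<cdot> u = f" using smallE assms(1,3) .
  obtain u' v' where uv': "u' \<in> Arr C" "v' \<in> Arr C" "Dom C u' = Dom C g" "Cod C v' = Cod C g"
    "Dom C v' = Cod C u'" "Cod C u' \<in> \<T>" "v' \<cdot> u' = g" using smallE assms(2,4) .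
  obtain S a b p q where S: "a \<in> Hom C (Cod C u) S" "b \<in> Hom C (Cod C u') S"
    "p \<in> Hom C S (Cod C u)" "q \<in> Hom C S (Cod C u')"
    and pa: "p \<cdot> a = Id C (Cod C u)" "q \<cdot> b = Id C (Cod C u')"
      "p \<cdot> b = Zero C (Cod C u') (Cod C u)" "q \<cdot> a = Zero C (Cod C u) (Cod C u')"
    and id: "a \<cdot> p \<oplus> b \<cdot> q = Id C S"
    using ex_biproduct[of "Cod C u" "Cod C u'"] uv(1) uv'(1) by (metis Cod_Obj)
  note S' = S[unfolded Hom_iff]
  have ST: "S \<in> \<T>" using T_biproduct[OF uv(6) uv'(6) S id] .
  let ?u = "a \<cdot> u \<oplus> b \<cdot> u'" and ?v = "v \<cdot> p \<oplus> v' \<cdot> q"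
  have t: "?u \<in> Arr C" "?v \<in> Arr C" "Dom C ?v = Cod C ?u" "Cod C ?u \<in> \<T>"
    using S' uv uv' ST assms(3-) by auto
  have "?v \<cdot> ?u = f \<oplus> g"
    using S' uv(1-6) uv'(1-6) assms(3-6)
    by (simp add: Comp_extend[OF pa(1)] Comp_extend[OF pa(2)] Comp_extend[OF pa(3)]
      Comp_extend[OF pa(4)] uv(7) uv'(7))
  then show ?thesis using smallI[OF t] by simp
qed

text \<open>Morphisms are congruent if they have the same class in the stable category.\<close>

definition sim :: "'m \<Rightarrow> 'm \<Rightarrow> bool" (infix "\<approx>" 50) where
  "f \<approx> g \<longleftrightarrow> f \<in> Arr C \<and> g \<in> Arr C \<and> Dom C f = Dom C g \<and> Cod C f = Cod C g \<and> small (f \<oplus> neg g)"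

lemma simD:
  assumes "f \<approx> g"
  shows "f \<in> Arr C" "g \<in> Arr C" "Dom C g = Dom C f" "Cod C g = Cod C f" "small (f \<oplus> neg g)"
  using assms by (auto simp: sim_def)

text \<open>Membership in the coset defining a stable class, in terms of congruence.\<close>

lemma sim_iff:
  "f \<approx> g \<longleftrightarrow> f \<in> Arr C \<and> (\<exists>t\<in>Arr C. Dom C t = Dom C f \<and> Cod C t = Cod C f \<and> small t \<and> g = f \<oplus> t)"
proof
  assume fg: "f \<approx> g"
  note h = simD[OF fg]
  have "f \<oplus> neg (f \<oplus> neg g) = g"
    by (rule Add_right_imp_eq[of _ "f \<oplus> neg g"]) (use h in \<open>simp_all add: Add_assoc\<close>,
      simp_all add: Add_left_commute[of g f] h)
  then show "f \<in> Arr C \<and> (\<exists>t\<in>Arr C. Dom C t = Dom C f \<and> Cod C t = Cod C f \<and> small t \<and> g = f \<oplus> t)"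
    using h small_neg[of "f \<oplus> neg g"] by (auto intro!: bexI[of _ "neg (f \<oplus> neg g)"])
next
  assume "f \<in> Arr C \<and> (\<exists>t\<in>Arr C. Dom C t = Dom C f \<and> Cod C t = Cod C f \<and> small t \<and> g = f \<oplus> t)"
  then obtain t where f: "f \<in> Arr C"
    and t: "t \<in> Arr C" "Dom C t = Dom C f" "Cod C t = Cod C f" "small t" "g = f \<oplus> t" by blast
  have "f \<oplus> neg (f \<oplus> t) = neg t"
    by (rule Add_right_imp_eq[of _ "f \<oplus> t"])
      (use f t(1-4) in \<open>simp_all add: Add_assoc\<close>, simp_all add: Add_left_commute[of "neg t" f t] f t(1-4))
  then show "f \<approx> g" using f t small_neg[of t] by (simp add: sim_def)
qed

end

section \<open>The stable category\<close>

text \<open>Passing to the stable category commutes with passing to the opposite category, so that duality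
  is available for stable statements too.\<close>

lemma stable_class_op_cat [simp]: "stable_class (op_cat C) \<T> = stable_class C \<T>"
  unfolding stable_class_def by simp

lemma stable_cat_op_cat [simp]: "stable_cat (op_cat C) \<T> = op_cat (stable_cat C \<T>)"
proof -
  have "(\<lambda>G F. \<Union>g\<in>G. \<Union>f\<in>F. stable_class C \<T> (f \<cdot>\<^bsub>C\<^esub> g)) =
      (\<lambda>G F. \<Union>f\<in>F. \<Union>g\<in>G. stable_class C \<T> (f \<cdot>\<^bsub>C\<^esub> g))"
    by (intro ext) blast
  then show ?thesis unfolding op_cat_def[of "stable_cat C \<T>"] by (simp add: stable_cat_def)
qed

context serre
begin

abbreviation \<S> where "\<S> \<equiv> stable_cat C \<T>"
abbreviation cls where "cls \<equiv> stable_class C \<T>"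

lemma sim_refl [simp]: "f \<in> Arr C \<Longrightarrow> f \<approx> f"
  by (simp add: sim_def small_Zero)

lemma sim_sym: "f \<approx> g \<Longrightarrow> g \<approx> f"
proof -
  assume fg: "f \<approx> g"
  note h = simD[OF fg]
  have "neg (f \<oplus> neg g) = g \<oplus> neg f"
    by (rule Add_right_imp_eq[of _ "f \<oplus> neg g"])
      (use h in \<open>simp_all add: Add_assoc\<close>)
  then show "g \<approx> f" using small_neg[of "f \<oplus> neg g"] h by (simp add: sim_def)
qed

lemma sim_trans [trans]:
  assumes "f \<approx> g" "g \<approx> h"
  shows "f \<approx> h"
proof -
  note fg = simD[OF assms(1)] and gh = simD[OF assms(2)]
  have "(f \<oplus> neg g) \<oplus> (g \<oplus> neg h) = f \<oplus> neg h" using fg(1-4) gh(1-4) by (simp add: Add_assoc)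
  then show ?thesis using small_Add[of "f \<oplus> neg g" "g \<oplus> neg h"] fg gh by (simp add: sim_def)
qed

lemma sim_Comp:
  assumes "f \<approx> f'" "g \<approx> g'" "Dom C g = Cod C f"
  shows "g \<cdot> f \<approx> g' \<cdot> f'"
proof -
  note f = simD[OF assms(1)] and g = simD[OF assms(2)]
  have "g \<cdot> f \<approx> g' \<cdot> f"
    using small_Comp_right[of "g \<oplus> neg g'" f] f g assms(3) by (simp add: sim_def)
  also have "\<dots> \<approx> g' \<cdot> f'"
    using small_Comp_left[of "f \<oplus> neg f'" g'] f g assms(3) by (simp add: sim_def)
  finally show ?thesis .
qed

lemma small_iff_sim_Zero: "f \<in> Arr C \<Longrightarrow> small f \<longleftrightarrow> f \<approx> Zero C (Dom C f) (Cod C f)"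
  by (simp add: sim_def)

lemma small_cong:
  assumes "f \<approx> g" "small g"
  shows "small f"
proof -
  note h = simD[OF assms(1)]
  have "g \<approx> Zero C (Dom C f) (Cod C f)" using small_iff_sim_Zero[of g] assms(2) h by simp
  then show ?thesis using sim_trans[OF assms(1)] small_iff_sim_Zero[of f] h by simp
qed

lemma mem_cls: "f \<in> Arr C \<Longrightarrow> x \<in> cls f \<longleftrightarrow> f \<approx> x"
  unfolding stable_class_def sim_iff Hom_iff by auto

lemma cls_eq_iff: "f \<in> Arr C \<Longrightarrow> g \<in> Arr C \<Longrightarrow> cls f = cls g \<longleftrightarrow> f \<approx> g"
  using mem_cls sim_refl sim_sym sim_trans by blast

lemma cls_eqI: "f \<approx> g \<Longrightarrow> cls f = cls g"
  using cls_eq_iff simD by blast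

lemma cls_small: "f \<in> Arr C \<Longrightarrow> small f \<Longrightarrow> cls f = cls (Zero C (Dom C f) (Cod C f))"
  using small_iff_sim_Zero cls_eqI by blast

lemma stable_Obj [simp]: "Obj \<S> = Obj C"
  by (simp add: stable_cat_def)

lemma stable_Arr: "Arr \<S> = cls ` Arr C"
  by (simp add: stable_cat_def)

lemma stable_Arr_cls [simp]: "f \<in> Arr C \<Longrightarrow> cls f \<in> Arr \<S>"
  by (simp add: stable_Arr)

lemma stable_Dom_Cod [simp]:
  assumes "f \<in> Arr C"
  shows "Dom \<S> (cls f) = Dom C f" "Cod \<S> (cls f) = Cod C f"
proof -
  have "f \<in> cls f" using assms by (simp add: mem_cls)
  then have "(SOME x. x \<in> cls f) \<in> cls f" by (rule someI)
  then have "f \<approx> (SOME x. x \<in> cls f)" using mem_cls assms by blast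
  then show "Dom \<S> (cls f) = Dom C f" "Cod \<S> (cls f) = Cod C f"
    using simD by (auto simp: stable_cat_def)
qed

lemma stable_Hom: "Hom \<S> M N = cls ` Hom C M N"
  by (auto simp: Hom_def stable_Arr)

lemma stable_HomE:
  assumes "F \<in> Hom \<S> M N"
  obtains f where "f \<in> Arr C" "Dom C f = M" "Cod C f = N" "F = cls f"
  using assms by (auto simp: stable_Hom Hom_iff)

lemma cls_Hom_iff [simp]:
  "f \<in> Arr C \<Longrightarrow> cls f \<in> Hom \<S> M N \<longleftrightarrow> Dom C f = M \<and> Cod C f = N"
  by (auto simp: Hom_def)

lemma stable_Id [simp]: "Id \<S> M = cls (Id C M)"
  by (simp add: stable_cat_def)

lemma stable_Comp [simp]:
  assumes "f \<in> Arr C" "g \<in> Arr C" "Dom C g = Cod C f"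
  shows "cls g \<cdot>\<^bsub>\<S>\<^esub> cls f = cls (g \<cdot> f)"
proof -
  have "cls (g' \<cdot> f') = cls (g \<cdot> f)" if "g' \<in> cls g" "f' \<in> cls f" for g' f'
    using that assms by (intro cls_eqI[symmetric] sim_Comp) (auto simp: mem_cls)
  moreover have "g \<in> cls g" "f \<in> cls f" using assms by (simp_all add: mem_cls)
  ultimately have "(\<Union>g'\<in>cls g. \<Union>f'\<in>cls f. cls (g' \<cdot> f')) = cls (g \<cdot> f)" by blast
  then show ?thesis by (simp add: stable_cat_def)
qed

text \<open>Monicity in the stable category, tested on zero morphisms and expressed by representatives.
  Together with the two lemmas after it, this lets the rest of the argument take place in
  \<open>C\<close> itself.\<close>

lemma stable_monic_iff:
  assumes "f \<in> Arr C"
  shows "monic \<S> (cls f) \<longleftrightarrow>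
    (\<forall>u\<in>Arr C. Cod C u = Dom C f \<longrightarrow> small (f \<cdot> u) \<longrightarrow> small u)"
proof
  assume f: "monic \<S> (cls f)"
  show "\<forall>u\<in>Arr C. Cod C u = Dom C f \<longrightarrow> small (f \<cdot> u) \<longrightarrow> small u"
  proof (intro ballI impI)
    fix u assume u: "u \<in> Arr C" "Cod C u = Dom C f" "small (f \<cdot> u)"
    let ?z = "Zero C (Dom C u) (Dom C f)"
    have "cls f \<cdot>\<^bsub>\<S>\<^esub> cls u = cls f \<cdot>\<^bsub>\<S>\<^esub> cls ?z"
      using u assms by (simp add: cls_eq_iff small_iff_sim_Zero)
    moreover have "cls u \<in> Hom \<S> (Dom C u) (Dom \<S> (cls f))" "cls ?z \<in> Hom \<S> (Dom C u) (Dom \<S> (cls f))"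
      "Dom C u \<in> Obj \<S>"
      using u assms by simp_all
    ultimately have "cls u = cls ?z"
      using f[unfolded monic_def, THEN conjunct2, rule_format] by metis
    then show "small u" using u assms by (simp add: cls_eq_iff small_iff_sim_Zero)
  qed
next
  assume f: "\<forall>u\<in>Arr C. Cod C u = Dom C f \<longrightarrow> small (f \<cdot> u) \<longrightarrow> small u"
  show "monic \<S> (cls f)"
    unfolding monic_def
  proof (intro conjI ballI impI)
    fix X U V assume U: "U \<in> Hom \<S> X (Dom \<S> (cls f))" and V: "V \<in> Hom \<S> X (Dom \<S> (cls f))"
      and eq: "cls f \<cdot>\<^bsub>\<S>\<^esub> U = cls f \<cdot>\<^bsub>\<S>\<^esub> V"
    obtain u where u: "u \<in> Arr C" "Dom C u = X" "Cod C u = Dom C f" "U = cls u"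
      using stable_HomE[OF U] assms by auto
    obtain v where v: "v \<in> Arr C" "Dom C v = X" "Cod C v = Dom C f" "V = cls v"
      using stable_HomE[OF V] assms by auto
    have "f \<cdot> u \<approx> f \<cdot> v" using eq u v assms by (simp add: cls_eq_iff)
    then have "small (f \<cdot> (u \<oplus> neg v))" using u v assms by (simp add: sim_def)
    then have "small (u \<oplus> neg v)" using f u v by simp
    then show "U = V" using u v by (simp add: cls_eq_iff sim_def)
  qed (use assms in simp)
qed

lemma stable_epic_iff:
  assumes "f \<in> Arr C"
  shows "epic \<S> (cls f) \<longleftrightarrow>
    (\<forall>u\<in>Arr C. Dom C u = Cod C f \<longrightarrow> small (u \<cdot> f) \<longrightarrow> small u)"
  using serre.stable_monic_iff[OF serre_op_cat, of f] assms by simp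

lemma stable_is_isom_iff:
  assumes "f \<in> Arr C"
  shows "is_isom \<S> (cls f) \<longleftrightarrow> (\<exists>g\<in>Arr C. Dom C g = Cod C f \<and> Cod C g = Dom C f \<and>
    g \<cdot> f \<approx> Id C (Dom C f) \<and> f \<cdot> g \<approx> Id C (Cod C f))"
  using assms unfolding is_isom_def stable_Hom
  by (auto simp: Hom_iff cls_eq_iff)

lemma stable_zero_objectI:
  assumes "P \<in> \<T>"
  shows "zero_object \<S> P"
  unfolding zero_object_def
proof (intro conjI ballI)
  show "P \<in> Obj \<S>" using assms by simp
  fix M assume "M \<in> Obj \<S>"
  then have M: "M \<in> Obj C" by simp
  show "\<exists>!f. f \<in> Hom \<S> P M"
  proof (rule ex1I[of _ "cls (Zero C P M)"])
    fix F assume "F \<in> Hom \<S> P M"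
    then show "F = cls (Zero C P M)"
      using cls_small small_Dom assms by (auto elim!: stable_HomE)
  qed (use M assms in simp)
  show "\<exists>!f. f \<in> Hom \<S> M P"
  proof (rule ex1I[of _ "cls (Zero C M P)"])
    fix F assume "F \<in> Hom \<S> M P"
    then show "F = cls (Zero C M P)"
      using cls_small small_Cod assms by (auto elim!: stable_HomE)
  qed (use M assms in simp)
qed

lemma stable_zero_objectD:
  assumes "zero_object \<S> Z" "f \<in> Arr C" "Cod C f = Z"
  shows "small f"
proof -
  have "cls f \<in> Hom \<S> (Dom C f) Z" "cls (Zero C (Dom C f) Z) \<in> Hom \<S> (Dom C f) Z" "Dom C f \<in> Obj \<S>"
    using assms by auto
  then have "cls f = cls (Zero C (Dom C f) Z)"
    using assms(1) unfolding zero_object_def by blast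
  then show ?thesis using assms by (auto simp: cls_eq_iff small_iff_sim_Zero)
qed

section \<open>Morphisms with kernel and cokernel in the Serre class\<close>

text \<open>As \<open>d\<close> is a cokernel of \<open>g\<close>, the object \<open>Dom C \<epsilon>\<close> is the preimage under \<open>f\<close> of
  the image of \<open>g\<close>. It is an extension of a subobject of that image, which is a quotient of an
  object of \<open>\<T>\<close>, by a subobject of the kernel of \<open>f\<close>.\<close>

lemma T_preimage:
  assumes \<kappa>: "is_kernel C \<kappa> f" "Dom C \<kappa> \<in> \<T>" and g: "Dom C g \<in> \<T>" "Cod C g = Cod C f"
    and d: "is_cokernel C g d" and \<epsilon>: "is_kernel C \<epsilon> (d \<cdot> f)"
  shows "Dom C \<epsilon> \<in> \<T>"
proof -
  note \<kappa>' = is_kernelD[OF \<kappa>(1)] and d' = is_cokernelD[OF d] and \<epsilon>' = is_kernelD[OF \<epsilon>]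
  \<comment> \<open>\<open>b\<close> is the image of \<open>g\<close>, and \<open>\<beta>\<close> below is the restriction of \<open>f\<close> to the preimage\<close>
  obtain b where b: "is_kernel C b d" using ex_kernel d' by blast
  note b' = is_kernelD[OF b]
  obtain e where "epic C e" "Dom C e = Dom C g" "Cod C e = Dom C b"
    using image_factorization[OF d b] .
  then have B: "Dom C b \<in> \<T>" using T_quotient[of e] g by simp
  have "Cod C \<epsilon> = Dom C f" using \<epsilon>' d' \<kappa>' g by simp
  note \<epsilon>'' = \<epsilon>'(1) this
  have "d \<cdot> (f \<cdot> \<epsilon>) = Zero C (Dom C \<epsilon>) (Cod C d)" using \<epsilon>' \<epsilon>'' d' \<kappa>' g by simp
  then obtain \<beta> where \<beta>: "\<beta> \<in> Arr C" "Dom C \<beta> = Dom C \<epsilon>" "Cod C \<beta> = Dom C b" "b \<cdot> \<beta> = f \<cdot> \<epsilon>"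
    using kernel_factor[OF b, of "f \<cdot> \<epsilon>"] \<epsilon>'' d' \<kappa>' g by auto
  obtain l where l: "is_kernel C l \<beta>" using ex_kernel \<beta> by blast
  note l' = is_kernelD[OF l]
  have "f \<cdot> (\<epsilon> \<cdot> l) = b \<cdot> (\<beta> \<cdot> l)"
    using Comp_extend[OF \<beta>(4), of l] l' \<beta>(1-3) \<epsilon>'' \<kappa>' b' by simp
  then have "f \<cdot> (\<epsilon> \<cdot> l) = Zero C (Dom C l) (Cod C f)" using l' b' \<beta>(1-3) d' g by simp
  \<comment> \<open>the kernel of \<open>\<beta>\<close> embeds into that of \<open>f\<close>\<close>
  then obtain w where w: "w \<in> Arr C" "Dom C w = Dom C l" "Cod C w = Dom C \<kappa>" "\<kappa> \<cdot> w = \<epsilon> \<cdot> l"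
    using kernel_factor[OF \<kappa>(1), of "\<epsilon> \<cdot> l"] l' \<epsilon>'' \<beta> by auto
  have "monic C w"
    unfolding monic_iff_cancel_zero
  proof (intro conjI ballI impI)
    fix u assume u: "u \<in> Arr C" "Cod C u = Dom C w" "w \<cdot> u = Zero C (Dom C u) (Cod C w)"
    have "\<epsilon> \<cdot> (l \<cdot> u) = Zero C (Dom C u) (Cod C \<epsilon>)"
      using Comp_extend[OF w(4), of u] u w(1-3) l' \<epsilon>'' \<beta> \<kappa>' by simp
    then have "l \<cdot> u = Zero C (Dom C u) (Dom C \<epsilon>)"
      using monic_zeroD[OF kernel_monic[OF \<epsilon>], of "l \<cdot> u"] u w(1-3) l' \<beta> by simp
    then show "u = Zero C (Dom C u) (Dom C w)"
      using monic_zeroD[OF kernel_monic[OF l], of u] u w(1-3) l' \<beta> by simp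
  qed (rule w)
  then have "Dom C l \<in> \<T>" using T_subobject[of w] w \<kappa> by simp
  then show ?thesis using T_extension[OF l] \<beta> B by simp
qed

text \<open>If \<open>f \<cdot> u\<close> factors through an object of \<open>\<T>\<close> by a last morphism \<open>g\<close>, then \<open>u\<close>
  factors through the preimage under \<open>f\<close> of the image of \<open>g\<close>. So a morphism with kernel in
  \<open>\<T>\<close> is monic in the stable category.\<close>

lemma small_cancel_left:
  assumes \<kappa>: "is_kernel C \<kappa> f" "Dom C \<kappa> \<in> \<T>" and u: "u \<in> Arr C" "Cod C u = Dom C f" "small (f \<cdot> u)"
  shows "small u"
proof -
  note \<kappa>' = is_kernelD[OF \<kappa>(1)]
  have fu: "f \<cdot> u \<in> Arr C" "Dom C (f \<cdot> u) = Dom C u" "Cod C (f \<cdot> u) = Cod C f"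
    using u \<kappa>' by simp_all
  obtain a g where g: "a \<in> Arr C" "g \<in> Arr C" "Dom C a = Dom C (f \<cdot> u)" "Cod C g = Cod C (f \<cdot> u)"
    "Dom C g = Cod C a" "Cod C a \<in> \<T>" "g \<cdot> a = f \<cdot> u"
    using smallE[OF u(3) fu(1)] .
  obtain d where d: "is_cokernel C g d" using ex_cokernel g by blast
  note d' = is_cokernelD[OF d]
  obtain \<epsilon> where \<epsilon>: "is_kernel C \<epsilon> (d \<cdot> f)" using ex_kernel d' \<kappa>' g fu by (metis Comp_simps(1))
  note \<epsilon>' = is_kernelD[OF \<epsilon>]
  have E: "Dom C \<epsilon> \<in> \<T>" using T_preimage[OF \<kappa> _ _ d \<epsilon>] g fu by simp
  have "d \<cdot> (f \<cdot> u) = Zero C (Dom C u) (Cod C d)"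
    using Comp_extend[OF d'(4), of a] g d' fu by simp
  then obtain w where w: "w \<in> Arr C" "Dom C w = Dom C u" "Cod C w = Dom C \<epsilon>" "\<epsilon> \<cdot> w = u"
    using kernel_factor[OF \<epsilon>, of u] u d' \<kappa>' g fu by auto
  then show ?thesis using smallI[of w \<epsilon>] \<epsilon>' E by simp
qed

lemma small_cancel_right:
  assumes "is_cokernel C f c" "Cod C c \<in> \<T>" "u \<in> Arr C" "Dom C u = Cod C f" "small (u \<cdot> f)"
  shows "small u"
  using serre.small_cancel_left[OF serre_op_cat, of c f u] assms by simp

end

text \<open>The morphisms that become invertible in the Serre quotient \<open>C / \<T>\<close>.\<close>

definition serre_isomorphism :: "('o, 'm) additive_cat \<Rightarrow> 'o set \<Rightarrow> 'm \<Rightarrow> bool" where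
  "serre_isomorphism C \<T> f \<longleftrightarrow>
    (\<exists>k c. is_kernel C k f \<and> is_cokernel C f c \<and> Dom C k \<in> \<T> \<and> Cod C c \<in> \<T>)"

lemma serre_isomorphism_op_cat [simp]:
  "serre_isomorphism (op_cat C) \<T> = serre_isomorphism C \<T>"
  by (auto simp: serre_isomorphism_def fun_eq_iff)

lemma (in serre) balanced_imp_serre_isomorphism_invertible:
  assumes "balanced \<S>" "serre_isomorphism C \<T> f"
  shows "is_isom \<S> (cls f)"
proof -
  obtain k c where k: "is_kernel C k f" "Dom C k \<in> \<T>" and c: "is_cokernel C f c" "Cod C c \<in> \<T>"
    using assms(2) unfolding serre_isomorphism_def by blast
  have f: "f \<in> Arr C" using k by (simp add: is_kernel_def)
  have "monic \<S> (cls f)" using stable_monic_iff[OF f] small_cancel_left[OF k] by blast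
  moreover have "epic \<S> (cls f)" using stable_epic_iff[OF f] small_cancel_right[OF c] by blast
  ultimately show ?thesis using assms(1) f by (simp add: balanced_def)
qed

section \<open>Splittings\<close>

text \<open>The self-dual condition through which all the others are compared. The second summand admits no
  nonzero morphism from or to objects of \<open>\<T>\<close>: its Hom conditions are membership in
  \<open>\<T>\<^sup>\<bottom>\<close> in the category and in its opposite. Since the components \<open>X \<rightarrow> Y\<close> and
  \<open>Y \<rightarrow> X\<close> are then zero anyway, the three equations say that \<open>M\<close> is a biproduct.\<close>

definition splits :: "('o, 'm) additive_cat \<Rightarrow> 'o set \<Rightarrow> bool" where
  "splits C \<T> \<longleftrightarrow> (\<forall>M\<in>Obj C. \<exists>X\<in>\<T>. \<exists>Y \<in> perp C \<T> \<inter> perp (op_cat C) \<T>.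
    \<exists>a\<in>Hom C X M. \<exists>b\<in>Hom C Y M. \<exists>p\<in>Hom C M X. \<exists>r\<in>Hom C M Y.
      p \<cdot>\<^bsub>C\<^esub> a = Id C X \<and> r \<cdot>\<^bsub>C\<^esub> b = Id C Y \<and> Add C (a \<cdot>\<^bsub>C\<^esub> p) (b \<cdot>\<^bsub>C\<^esub> r) = Id C M)"

lemma splits_op_catD: "splits (op_cat C) \<T> \<Longrightarrow> splits C \<T>"
  unfolding splits_def op_op_cat op_cat_simps Hom_op_cat Int_commute[of "perp (op_cat C) \<T>"]
  by blast

context serre
begin

lemma perpD:
  assumes "Y \<in> perp C \<T>" "f \<in> Arr C" "Cod C f = Y" "Dom C f \<in> \<T>"
  shows "f = Zero C (Dom C f) Y"
  using assms unfolding perp_def Hom_def by blast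

lemma coperpD:
  assumes "Y \<in> perp (op_cat C) \<T>" "f \<in> Arr C" "Dom C f = Y" "Cod C f \<in> \<T>"
  shows "f = Zero C Y (Cod C f)"
  using serre.perpD[OF serre_op_cat, of Y f] assms by simp

lemma perp_Obj: "Y \<in> perp C \<T> \<Longrightarrow> Y \<in> Obj C"
  by (simp add: perp_def)

lemma small_into_perp:
  assumes "Y \<in> perp C \<T>" "small f" "f \<in> Arr C" "Cod C f = Y"
  shows "f = Zero C (Dom C f) Y"
proof -
  obtain u v where uv: "u \<in> Arr C" "v \<in> Arr C" "Dom C u = Dom C f" "Cod C v = Cod C f"
    "Dom C v = Cod C u" "Cod C u \<in> \<T>" "v \<cdot> u = f" using smallE assms(2,3) .
  have "v = Zero C (Dom C v) Y" by (rule perpD) (use assms uv in simp_all)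
  then have "v \<cdot> u = Zero C (Dom C v) Y \<cdot> u" by simp
  then show ?thesis using uv assms(4) perp_Obj[OF assms(1)] by simp
qed

text \<open>Stable equality is equality for morphisms into \<open>\<T>\<^sup>\<bottom>\<close>: this turns stable inverses into
  genuine one-sided inverses.\<close>

lemma sim_into_perp:
  assumes "Y \<in> perp C \<T>" "f \<approx> g" "Cod C f = Y"
  shows "f = g"
proof -
  note h = simD[OF assms(2)]
  have "f \<oplus> neg g = Zero C (Dom C f) (Cod C f)"
    using small_into_perp[of Y "f \<oplus> neg g"] h assms(1,3) by simp
  then show ?thesis by (subst eq_iff_diff_zero) (use h in simp_all)
qed

lemma monic_kernel_in_T:
  assumes "monic C f" "is_kernel C k f"
  shows "Dom C k \<in> \<T>"
proof (rule T_of_Id_eq_Zero)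
  note k = is_kernelD[OF assms(2)]
  show "Dom C k \<in> Obj C" using k by simp
  show "Id C (Dom C k) = Zero C (Dom C k) (Dom C k)"
  proof -
    have "k = Zero C (Dom C k) (Dom C f)" using monic_zeroD[OF assms(1) k(4,1,3)] .
    then have "k \<cdot> Id C (Dom C k) = Zero C (Dom C k) (Dom C f)" using k by simp
    then show ?thesis
      using monic_zeroD[OF kernel_monic[OF assms(2)], of "Id C (Dom C k)"] k by simp
  qed
qed

lemma epic_cokernel_in_T:
  assumes "epic C f" "is_cokernel C f c"
  shows "Cod C c \<in> \<T>"
  using serre.monic_kernel_in_T[OF serre_op_cat, of f c] assms by simp

text \<open>The image \<open>m\<close> of a precover of \<open>M\<close> is the largest subobject of \<open>M\<close> in \<open>\<T>\<close>, and
  the quotient \<open>c : M \<rightarrow> N\<close> by it is a Serre isomorphism with \<open>N\<close> in \<open>\<T>\<^sup>\<bottom>\<close>. A stable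
  inverse of \<open>c\<close> is thus a section of \<open>c\<close>, and \<open>M\<close> splits. For \<open>f : N \<rightarrow> T\<close> with
  \<open>T\<close> in \<open>\<T>\<close>, the kernel \<open>\<kappa>\<close> of \<open>f\<close> is a Serre isomorphism into \<open>N\<close>, so by the
  same argument it has a section and \<open>f = 0\<close>.\<close>

lemma splits_if_contravariantly_finite:
  assumes inv: "\<And>f. serre_isomorphism C \<T> f \<Longrightarrow> is_isom \<S> (cls f)"
    and fin: "contravariantly_finite C \<T>"
  shows "splits C \<T>"
  unfolding splits_def
proof
  fix M assume M: "M \<in> Obj C"
  then obtain j where "precover C \<T> M j" using fin by (auto simp: contravariantly_finite_def)
  then have j: "j \<in> Arr C" "Cod C j = M" "Dom C j \<in> \<T>"
    and j_univ: "\<And>T g. T \<in> \<T> \<Longrightarrow> g \<in> Hom C T M \<Longrightarrow> \<exists>h\<in>Hom C T (Dom C j). j \<cdot> h = g"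
    unfolding precover_def preenvelope_def by auto
  obtain c where c: "is_cokernel C j c" using ex_cokernel j by blast
  note c' = is_cokernelD[OF c]
  obtain m where m: "is_kernel C m c" using ex_kernel c' by blast
  note m' = is_kernelD[OF m]
  obtain e where e: "epic C e" "e \<in> Arr C" "Dom C e = Dom C j" "Cod C e = Dom C m" "m \<cdot> e = j"
    using image_factorization[OF c m] .
  have X: "Dom C m \<in> \<T>" using T_quotient[OF e(1)] e j by simp
  let ?N = "Cod C c"
  have N: "?N \<in> Obj C" using c' by simp
  have factor: "c \<cdot> g = Zero C (Dom C g) ?N" if g: "g \<in> Arr C" "Cod C g = M" "Dom C g \<in> \<T>" for g
  proof -
    obtain h where h: "h \<in> Arr C" "Dom C h = Dom C g" "Cod C h = Dom C j" "j \<cdot> h = g"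
      using j_univ[of "Dom C g" g] g by (auto simp: Hom_iff)
    show ?thesis using Comp_extend[OF c'(4), of h] h j c' by simp
  qed
  have N_perp: "?N \<in> perp C \<T>"
    unfolding perp_def
  proof (intro CollectI conjI ballI equalityI subsetI)
    fix T g assume T: "T \<in> \<T>" and "g \<in> Hom C T ?N"
    then have g: "g \<in> Arr C" "Dom C g = T" "Cod C g = ?N" by (auto simp: Hom_iff)
    obtain d where d: "is_cokernel C g d" using ex_cokernel g by blast
    note d' = is_cokernelD[OF d]
    have dc: "d \<cdot> c \<in> Arr C" "Dom C (d \<cdot> c) = M" "Cod C (d \<cdot> c) = Cod C d"
      using d' c' g j by simp_all
    obtain \<epsilon> where \<epsilon>: "is_kernel C \<epsilon> (d \<cdot> c)" using ex_kernel dc by blast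
    note \<epsilon>' = is_kernelD[OF \<epsilon>]
    have "Dom C \<epsilon> \<in> \<T>" using T_preimage[OF m X _ _ d \<epsilon>] g T by simp
    \<comment> \<open>the preimage of the image of \<open>g\<close> lies in \<open>\<T>\<close>, hence inside \<open>m\<close>\<close>
    then have c\<epsilon>: "c \<cdot> \<epsilon> = Zero C (Dom C \<epsilon>) ?N" using factor \<epsilon>' dc by simp
    have "epic C (d \<cdot> c)"
      unfolding epic_def
    proof (intro conjI ballI impI)
      fix Z u v assume "u \<in> Hom C (Cod C (d \<cdot> c)) Z" "v \<in> Hom C (Cod C (d \<cdot> c)) Z"
        and eq: "u \<cdot> (d \<cdot> c) = v \<cdot> (d \<cdot> c)"
      then have uv: "u \<in> Arr C" "v \<in> Arr C" "Dom C u = Cod C d" "Dom C v = Cod C d"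
        "Cod C v = Cod C u" using dc by (auto simp: Hom_iff)
      have "u \<cdot> d = v \<cdot> d"
        by (rule epicD[OF cokernel_epic[OF c]]) (use eq uv d' c' g in simp_all)
      then show "u = v" by (rule epicD[OF cokernel_epic[OF d]]) (use uv d' in simp_all)
    qed (rule dc)
    then have coker: "is_cokernel C \<epsilon> (d \<cdot> c)" using epic_is_cokernel_of_kernel \<epsilon> by blast
    \<comment> \<open>\<open>c\<close> factors through \<open>d \<cdot> c\<close>, which makes \<open>d\<close> split monic; but \<open>d \<cdot> g = 0\<close>\<close>
    obtain v where v: "v \<in> Arr C" "Cod C v = ?N" "Dom C v = Cod C d" "v \<cdot> (d \<cdot> c) = c"
      using cokernel_factor[OF coker, of c] c\<epsilon> c' \<epsilon>' dc j by auto
    have "(v \<cdot> d) \<cdot> c = Id C ?N \<cdot> c" using v d' c' g by simp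
    then have vd: "v \<cdot> d = Id C ?N"
      by (rule epicD[OF cokernel_epic[OF c]]) (use v d' c' g N in simp_all)
    have "g = (v \<cdot> d) \<cdot> g" using vd g by simp
    also have "\<dots> = v \<cdot> (d \<cdot> g)" using v d' g by (simp del: Comp_Id_simps)
    also have "\<dots> = Zero C T ?N" using v d' g N T by simp
    finally show "g \<in> {Zero C T ?N}" by simp
  qed (use N in \<open>auto simp: Hom_iff\<close>)
  obtain z where z: "is_cokernel C c z" using ex_cokernel c' by blast
  have "serre_isomorphism C \<T> c"
    unfolding serre_isomorphism_def
    using m X z epic_cokernel_in_T[OF cokernel_epic[OF c] z] by blast
  then obtain s where s: "s \<in> Arr C" "Dom C s = ?N" "Cod C s = M" "c \<cdot> s \<approx> Id C ?N"
    using inv stable_is_isom_iff[of c] c' j by auto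
  have cs: "c \<cdot> s = Id C ?N" by (rule sim_into_perp[OF N_perp s(4)]) (use s c' j in simp)
  \<comment> \<open>the complementary idempotent of \<open>s \<cdot> c\<close> factors through \<open>m\<close>\<close>
  have "Id C M \<oplus> neg (s \<cdot> c) \<in> Arr C" "Dom C (Id C M \<oplus> neg (s \<cdot> c)) = M"
    "Cod C (Id C M \<oplus> neg (s \<cdot> c)) = M"
    using s c' M j by simp_all
  moreover have "c \<cdot> (Id C M \<oplus> neg (s \<cdot> c)) = Zero C M ?N"
    using s c' M j by (simp add: Comp_extend[OF cs])
  ultimately obtain w where w: "w \<in> Arr C" "Dom C w = M" "Cod C w = Dom C m"
    "m \<cdot> w = Id C M \<oplus> neg (s \<cdot> c)"
    using kernel_factor[OF m, of "Id C M \<oplus> neg (s \<cdot> c)"] c' j by auto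
  have "m \<cdot> (w \<cdot> m) = (Id C M \<oplus> neg (s \<cdot> c)) \<cdot> m"
    by (rule Comp_extend[OF w(4)]) (use w m' c' j in simp_all)
  also have "\<dots> = m \<cdot> Id C (Dom C m)" using s c' m' j M by simp
  finally have wm: "w \<cdot> m = Id C (Dom C m)"
    by (rule monicD[OF kernel_monic[OF m]]) (use w m' c' j in simp_all)
  have sum: "m \<cdot> w \<oplus> s \<cdot> c = Id C M"
    unfolding w(4) using s c' M j by (simp add: Add_assoc)
  have N_coperp: "?N \<in> perp (op_cat C) \<T>"
    unfolding perp_def
  proof (intro CollectI conjI ballI equalityI subsetI)
    fix T f assume T: "T \<in> \<T>" and "f \<in> Hom (op_cat C) T ?N"
    then have f: "f \<in> Arr C" "Dom C f = ?N" "Cod C f = T" by (auto simp: Hom_iff)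
    obtain \<kappa> where \<kappa>: "is_kernel C \<kappa> f" using ex_kernel f by blast
    note \<kappa>' = is_kernelD[OF \<kappa>]
    obtain x where x: "is_cokernel C \<kappa> x" using ex_cokernel \<kappa>' by blast
    obtain n where n: "monic C n" "n \<in> Arr C" "Cod C n = Cod C f" "Dom C n = Cod C x"
      using coimage_factorization[OF \<kappa> x] .
    have "Cod C x \<in> \<T>" using T_subobject[OF n(1)] n f T by simp
    moreover obtain l where "is_kernel C l \<kappa>" using ex_kernel \<kappa>' by blast
    ultimately have "serre_isomorphism C \<T> \<kappa>"
      unfolding serre_isomorphism_def
      using x monic_kernel_in_T[OF kernel_monic[OF \<kappa>]] by blast
    then obtain t where t: "t \<in> Arr C" "Dom C t = ?N" "Cod C t = Dom C \<kappa>" "\<kappa> \<cdot> t \<approx> Id C ?N"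
      using inv stable_is_isom_iff[of \<kappa>] \<kappa>' f by auto
    have \<kappa>t: "\<kappa> \<cdot> t = Id C ?N" by (rule sim_into_perp[OF N_perp t(4)]) (use t \<kappa>' f in simp)
    have "f \<cdot> (\<kappa> \<cdot> t) = Zero C ?N T"
      using Comp_extend[OF \<kappa>'(4), of t] t \<kappa>' f T by simp
    then show "f \<in> {Zero (op_cat C) T ?N}" using \<kappa>t f by simp
  qed (use N in \<open>auto simp: Hom_iff\<close>)
  show "\<exists>X\<in>\<T>. \<exists>Y \<in> perp C \<T> \<inter> perp (op_cat C) \<T>.
    \<exists>a\<in>Hom C X M. \<exists>b\<in>Hom C Y M. \<exists>p\<in>Hom C M X. \<exists>r\<in>Hom C M Y.
      p \<cdot> a = Id C X \<and> r \<cdot> b = Id C Y \<and> a \<cdot> p \<oplus> b \<cdot> r = Id C M"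
    by (intro bexI[of _ "Dom C m"] bexI[of _ ?N] bexI[of _ m] bexI[of _ s] bexI[of _ w] bexI[of _ c])
      (use X N_perp N_coperp m' s(1-3) w(1-3) c' j wm cs sum in \<open>simp_all add: Hom_iff\<close>)
qed

lemma splits_if_covariantly_finite:
  assumes "\<And>f. serre_isomorphism C \<T> f \<Longrightarrow> is_isom \<S> (cls f)" "covariantly_finite C \<T>"
  shows "splits C \<T>"
proof -
  have "contravariantly_finite (op_cat C) \<T>"
    using assms(2) by (simp add: contravariantly_finite_def covariantly_finite_def precover_def)
  then have "splits (op_cat C) \<T>"
    using serre.splits_if_contravariantly_finite[OF serre_op_cat] assms(1) by simp
  then show ?thesis by (rule splits_op_catD)
qed

lemma splitsE:
  assumes "splits C \<T>" "M \<in> Obj C"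
  obtains X Y a b p r where "X \<in> \<T>" "Y \<in> perp C \<T>" "Y \<in> perp (op_cat C) \<T>"
    "a \<in> Arr C" "Dom C a = X" "Cod C a = M" "b \<in> Arr C" "Dom C b = Y" "Cod C b = M"
    "p \<in> Arr C" "Dom C p = M" "Cod C p = X" "r \<in> Arr C" "Dom C r = M" "Cod C r = Y"
    "p \<cdot> a = Id C X" "r \<cdot> b = Id C Y" "a \<cdot> p \<oplus> b \<cdot> r = Id C M"
proof -
  have "\<exists>X\<in>\<T>. \<exists>Y \<in> perp C \<T> \<inter> perp (op_cat C) \<T>.
    \<exists>a\<in>Hom C X M. \<exists>b\<in>Hom C Y M. \<exists>p\<in>Hom C M X. \<exists>r\<in>Hom C M Y.
      p \<cdot> a = Id C X \<and> r \<cdot> b = Id C Y \<and> a \<cdot> p \<oplus> b \<cdot> r = Id C M"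
    using assms unfolding splits_def by (rule bspec)
  then obtain X Y a b p r where "X \<in> \<T>" "Y \<in> perp C \<T> \<inter> perp (op_cat C) \<T>"
    "a \<in> Hom C X M" "b \<in> Hom C Y M" "p \<in> Hom C M X" "r \<in> Hom C M Y"
    "p \<cdot> a = Id C X" "r \<cdot> b = Id C Y" "a \<cdot> p \<oplus> b \<cdot> r = Id C M"
    by (elim bexE conjE)
  then show thesis by (intro that[of X Y a b p r]) (simp_all only: Hom_iff Int_iff)
qed

lemma splits_op_cat: "splits C \<T> \<Longrightarrow> splits (op_cat C) \<T>"
  using splits_op_catD[of "op_cat C" \<T>] by simp

text \<open>The injection of the summand in \<open>\<T>\<close> is a precover, as morphisms from \<open>\<T>\<close> have no
  component in the other summand.\<close>

lemma splits_imp_contravariantly_finite: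
  assumes "splits C \<T>"
  shows "contravariantly_finite C \<T>"
  unfolding contravariantly_finite_def
proof
  fix M assume "M \<in> Obj C"
  then obtain X Y a b p r where XY: "X \<in> \<T>" "Y \<in> perp C \<T>"
    and h: "a \<in> Arr C" "Dom C a = X" "Cod C a = M" "b \<in> Arr C" "Dom C b = Y" "Cod C b = M"
    "p \<in> Arr C" "Dom C p = M" "Cod C p = X" "r \<in> Arr C" "Dom C r = M" "Cod C r = Y"
    and id: "a \<cdot> p \<oplus> b \<cdot> r = Id C M"
    using splitsE[OF assms] by metis
  have "\<exists>k\<in>Hom C T X. a \<cdot> k = g" if T: "T \<in> \<T>" and g: "g \<in> Hom C T M" for T g
  proof -
    have g': "g \<in> Arr C" "Dom C g = T" "Cod C g = M" using g by (auto simp: Hom_iff)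
    have rg: "r \<cdot> g = Zero C T Y" using perpD[OF XY(2), of "r \<cdot> g"] g' h T by simp
    have "g = (a \<cdot> p \<oplus> b \<cdot> r) \<cdot> g" using id g' by simp
    also have "\<dots> = a \<cdot> (p \<cdot> g)"
      using g' h T by (simp add: rg del: Comp_Id_simps)
    finally have "a \<cdot> (p \<cdot> g) = g" by simp
    then show ?thesis using g' h by (intro bexI[of _ "p \<cdot> g"]) (simp_all add: Hom_iff)
  qed
  then have "precover C \<T> M a"
    unfolding precover_def preenvelope_def using h XY by simp
  then show "\<exists>j. precover C \<T> M j" ..
qed

lemma splits_imp_functorially_finite:
  assumes "splits C \<T>"
  shows "functorially_finite C \<T>"
proof -
  have "contravariantly_finite (op_cat C) \<T>"
    using serre.splits_imp_contravariantly_finite[OF serre_op_cat] splits_op_cat assms by blast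
  then have "covariantly_finite C \<T>"
    by (simp add: contravariantly_finite_def covariantly_finite_def precover_def)
  then show ?thesis
    using splits_imp_contravariantly_finite[OF assms] by (simp add: functorially_finite_def)
qed

end

section \<open>Balancedness and 2-decompositions from splittings\<close>

context serre
begin

text \<open>The compression \<open>r' \<cdot> f \<cdot> b\<close> of \<open>f\<close> to the complements of the summands in \<open>\<T>\<close> is
  stably the same as \<open>f\<close>. If it kills \<open>u\<close> then \<open>f \<cdot> b \<cdot> u\<close> factors through the other
  summand, so \<open>b \<cdot> u\<close> and \<open>u\<close> are small; but small morphisms into \<open>\<T>\<^sup>\<bottom>\<close> are zero.\<close>

lemma torsionfree_part_monic:
  assumes f: "f \<in> Arr C" "monic \<S> (cls f)"
    and Y: "Y \<in> perp C \<T>" and b: "b \<in> Arr C" "Dom C b = Y" "Cod C b = Dom C f"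
    and r: "r \<in> Arr C" "Dom C r = Dom C f" "Cod C r = Y" and rb: "r \<cdot> b = Id C Y"
    and X': "X' \<in> \<T>" and a': "a' \<in> Arr C" "Dom C a' = X'" "Cod C a' = Cod C f"
    and p': "p' \<in> Arr C" "Dom C p' = Cod C f" "Cod C p' = X'"
    and b': "b' \<in> Arr C" "Dom C b' = Y'" "Cod C b' = Cod C f"
    and r': "r' \<in> Arr C" "Dom C r' = Cod C f" "Cod C r' = Y'"
    and sum: "a' \<cdot> p' \<oplus> b' \<cdot> r' = Id C (Cod C f)"
  shows "monic C (r' \<cdot> (f \<cdot> b))"
  unfolding monic_iff_cancel_zero
proof (intro conjI ballI impI)
  show "r' \<cdot> (f \<cdot> b) \<in> Arr C" using r' f b by simp
  fix u assume "u \<in> Arr C" "Cod C u = Dom C (r' \<cdot> (f \<cdot> b))"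
    "(r' \<cdot> (f \<cdot> b)) \<cdot> u = Zero C (Dom C u) (Cod C (r' \<cdot> (f \<cdot> b)))"
  then have u: "u \<in> Arr C" "Cod C u = Y" "r' \<cdot> (f \<cdot> (b \<cdot> u)) = Zero C (Dom C u) Y'"
    using r' f b by simp_all
  have Y': "Y' \<in> Obj C" using b' by auto
  have "f \<cdot> (b \<cdot> u) = (a' \<cdot> p' \<oplus> b' \<cdot> r') \<cdot> (f \<cdot> (b \<cdot> u))"
    using sum u f b by simp
  also have "\<dots> = a' \<cdot> (p' \<cdot> (f \<cdot> (b \<cdot> u)))"
    using u f b a' p' b' r' Y' by (simp del: Comp_Id_simps)
  finally have "small (f \<cdot> (b \<cdot> u))"
    using smallI[of "p' \<cdot> (f \<cdot> (b \<cdot> u))" a'] X' a' p' f b u by simp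
  then have "small (b \<cdot> u)"
    using f stable_monic_iff[OF f(1)] b u by simp
  then have "small (r \<cdot> (b \<cdot> u))" using small_Comp_left[of "b \<cdot> u" r] r b u by simp
  then have "small u" using Comp_extend[OF rb, of u] r b u by simp
  then show "u = Zero C (Dom C u) (Dom C (r' \<cdot> (f \<cdot> b)))"
    using small_into_perp[OF Y] u r' f b by simp
qed

text \<open>The stable category is equivalent to the full subcategory of the objects \<open>Y\<close> without nonzero
  morphisms from or to \<open>\<T>\<close>. The compression of a stably monic and epic morphism to these is monic and
  epic in \<open>C\<close>, hence invertible since \<open>C\<close> is abelian, and its inverse \<open>h\<close> gives a stable
  inverse.\<close>

lemma splits_imp_balanced:
  assumes "splits C \<T>"
  shows "balanced \<S>"
  unfolding balanced_def
proof (intro ballI impI, elim conjE)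
  fix F assume "F \<in> Arr \<S>" and monic: "monic \<S> F" and epic: "epic \<S> F"
  then obtain f where f: "f \<in> Arr C" and F: "F = cls f" by (auto simp: stable_Arr)
  obtain X Y a b p r where XY: "X \<in> \<T>" "Y \<in> perp C \<T>"
    and a: "a \<in> Arr C" "Dom C a = X" "Cod C a = Dom C f"
    and b: "b \<in> Arr C" "Dom C b = Y" "Cod C b = Dom C f"
    and p: "p \<in> Arr C" "Dom C p = Dom C f" "Cod C p = X"
    and r: "r \<in> Arr C" "Dom C r = Dom C f" "Cod C r = Y"
    and rb: "r \<cdot> b = Id C Y" and sum: "a \<cdot> p \<oplus> b \<cdot> r = Id C (Dom C f)"
    using splitsE[OF assms Dom_Obj[OF f]] .
  obtain X' Y' a' b' p' r' where XY': "X' \<in> \<T>" "Y' \<in> perp (op_cat C) \<T>"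
    and a': "a' \<in> Arr C" "Dom C a' = X'" "Cod C a' = Cod C f"
    and b': "b' \<in> Arr C" "Dom C b' = Y'" "Cod C b' = Cod C f"
    and p': "p' \<in> Arr C" "Dom C p' = Cod C f" "Cod C p' = X'"
    and r': "r' \<in> Arr C" "Dom C r' = Cod C f" "Cod C r' = Y'"
    and rb': "r' \<cdot> b' = Id C Y'" and sum': "a' \<cdot> p' \<oplus> b' \<cdot> r' = Id C (Cod C f)"
    using splitsE[OF assms Cod_Obj[OF f]] .
  let ?g = "r' \<cdot> (f \<cdot> b)"
  have g: "?g \<in> Arr C" "Dom C ?g = Y" "Cod C ?g = Y'" using f b r' by simp_all
  have "monic C ?g"
    by (rule torsionfree_part_monic[OF f _ XY(2) b r rb XY'(1) a' p' b' r' sum'])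
      (use monic F in simp)
  moreover have "epic C ?g"
  proof -
    interpret op: serre "op_cat C" \<T> by (rule serre_op_cat)
    have "monic (op_cat C) (b \<cdot>\<^bsub>op_cat C\<^esub> (f \<cdot>\<^bsub>op_cat C\<^esub> r'))"
      by (rule op.torsionfree_part_monic[where X' = X and Y' = Y and a' = p and p' = a and b' = r
          and r = b' and Y = Y'])
        (use f epic F XY XY' a b p r a' b' p' r' rb' sum in simp_all)
    then show ?thesis using f b r' by simp
  qed
  ultimately have "is_isom C ?g" by (rule monic_epic_is_isom)
  then obtain h where h: "h \<in> Arr C" "Dom C h = Y'" "Cod C h = Y"
    "h \<cdot> ?g = Id C Y" "?g \<cdot> h = Id C Y'"
    using g by (auto simp: is_isom_def Hom_iff)
  have br: "b \<cdot> r \<approx> Id C (Dom C f)"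
    unfolding sim_iff
    by (intro conjI bexI[of _ "a \<cdot> p"])
      (use a b p r XY smallI[of p a] sum Add_commute[of "a \<cdot> p" "b \<cdot> r"] in simp_all)
  have br': "b' \<cdot> r' \<approx> Id C (Cod C f)"
    unfolding sim_iff
    by (intro conjI bexI[of _ "a' \<cdot> p'"])
      (use a' b' p' r' XY' smallI[of p' a'] sum' Add_commute[of "a' \<cdot> p'" "b' \<cdot> r'"] in simp_all)
  let ?s = "b \<cdot> (h \<cdot> r')"
  have s: "?s \<in> Arr C" "Dom C ?s = Cod C f" "Cod C ?s = Dom C f" using b h r' by simp_all
  have "?s \<cdot> f \<approx> Id C (Dom C f)"
  proof -
    have "?s \<cdot> f = (?s \<cdot> f) \<cdot> Id C (Dom C f)" using s f by simp
    also have "\<dots> \<approx> (?s \<cdot> f) \<cdot> (b \<cdot> r)"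
      by (rule sim_Comp[OF sim_sym[OF br]]) (use s f in simp_all)
    also have "(?s \<cdot> f) \<cdot> (b \<cdot> r) = b \<cdot> ((h \<cdot> ?g) \<cdot> r)"
      using h(1-3) f b r r' by (simp del: Comp_Id_simps)
    also have "\<dots> = b \<cdot> r" unfolding h(4) using r by simp
    also have "\<dots> \<approx> Id C (Dom C f)" by (rule br)
    finally show ?thesis .
  qed
  moreover have "f \<cdot> ?s \<approx> Id C (Cod C f)"
  proof -
    have "f \<cdot> ?s = Id C (Cod C f) \<cdot> (f \<cdot> ?s)" using s f by simp
    also have "\<dots> \<approx> (b' \<cdot> r') \<cdot> (f \<cdot> ?s)"
      by (rule sim_Comp[OF _ sim_sym[OF br']]) (use s f in simp_all)
    also have "(b' \<cdot> r') \<cdot> (f \<cdot> ?s) = b' \<cdot> ((?g \<cdot> h) \<cdot> r')"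
      using h(1-3) f b b' r' by (simp del: Comp_Id_simps)
    also have "\<dots> = b' \<cdot> r'" unfolding h(5) using r' by simp
    also have "\<dots> \<approx> Id C (Cod C f)" by (rule br')
    finally show ?thesis .
  qed
  ultimately show "is_isom \<S> F"
    unfolding F stable_is_isom_iff[OF f] using s by blast
qed

lemma is_isomE:
  assumes "is_isom C f"
  obtains g where "f \<in> Arr C" "g \<in> Arr C" "Dom C g = Cod C f" "Cod C g = Dom C f"
    "g \<cdot> f = Id C (Dom C f)" "f \<cdot> g = Id C (Cod C f)"
proof -
  obtain g where "g \<in> Hom C (Cod C f) (Dom C f)" "g \<cdot> f = Id C (Dom C f)" "f \<cdot> g = Id C (Cod C f)"
    using assms unfolding is_isom_def by blast
  moreover have "f \<in> Arr C" using assms by (simp add: is_isom_def)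
  ultimately show thesis using that[of g] by (simp add: Hom_iff)
qed

lemma iso_closed_T: "iso_closed C \<T>"
  unfolding iso_closed_def isomorphic_def
proof (intro ballI impI, elim bexE)
  fix M N f assume M: "M \<in> \<T>" and f: "f \<in> Hom C M N" and "is_isom C f"
  then obtain g where g: "g \<in> Arr C" "Dom C g = Cod C f" "Cod C g = Dom C f"
    "f \<cdot> g = Id C (Cod C f)" and f': "f \<in> Arr C"
    using is_isomE[of f] by metis
  have "epic C f"
    unfolding epic_def
  proof (intro conjI ballI impI)
    fix Z u v assume "u \<in> Hom C (Cod C f) Z" "v \<in> Hom C (Cod C f) Z" and eq: "u \<cdot> f = v \<cdot> f"
    then have uv: "u \<in> Arr C" "v \<in> Arr C" "Dom C u = Cod C f" "Dom C v = Cod C f"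
      by (auto simp: Hom_iff)
    have "u \<cdot> (f \<cdot> g) = v \<cdot> (f \<cdot> g)" using Comp_extend[OF eq, of g] uv g(1-3) f' by simp
    then show "u = v" using g(4) uv by simp
  qed (rule f')
  then show "N \<in> \<T>" using T_quotient[of f] M f by (auto simp: Hom_iff)
qed

lemma iso_closed_perp: "iso_closed C (perp C \<T>)"
  unfolding iso_closed_def isomorphic_def
proof (intro ballI impI, elim bexE)
  fix M N f assume M: "M \<in> perp C \<T>" and N: "N \<in> Obj C" and f: "f \<in> Hom C M N" and "is_isom C f"
  then obtain g where g: "g \<in> Arr C" "Dom C g = N" "Cod C g = M" "f \<cdot> g = Id C N"
    using is_isomE[of f] by (metis Hom_iff)
  show "N \<in> perp C \<T>"
    unfolding perp_def
  proof (intro CollectI conjI ballI equalityI subsetI)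
    fix T h assume T: "T \<in> \<T>" and "h \<in> Hom C T N"
    then have h: "h \<in> Arr C" "Dom C h = T" "Cod C h = N" by (auto simp: Hom_iff)
    have "g \<cdot> h = Zero C T M" using perpD[OF M, of "g \<cdot> h"] g h T by simp
    then have "h = Zero C T N"
      using Comp_extend[OF g(4), of h] g(1-3) h f T by (simp add: Hom_iff)
    then show "h \<in> {Zero C T N}" by simp
  qed (use N in \<open>auto simp: Hom_iff\<close>)
qed

text \<open>The summand of \<open>Y\<close> in \<open>\<T>\<close> has zero injection into \<open>Y\<close>, so every morphism out of
  \<open>Y\<close> is determined on the other summand.\<close>

lemma splits_perp_subset:
  assumes "splits C \<T>" "Y \<in> perp C \<T>"
  shows "Y \<in> perp (op_cat C) \<T>"
  unfolding perp_def
proof (intro CollectI conjI ballI equalityI subsetI)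
  obtain X Y0 a b p r where XY: "X \<in> \<T>" "Y0 \<in> perp (op_cat C) \<T>"
    and a: "a \<in> Arr C" "Dom C a = X" "Cod C a = Y"
    and b: "b \<in> Arr C" "Dom C b = Y0" "Cod C b = Y"
    and p: "p \<in> Arr C" "Dom C p = Y" "Cod C p = X"
    and r: "r \<in> Arr C" "Dom C r = Y" "Cod C r = Y0"
    and sum: "a \<cdot> p \<oplus> b \<cdot> r = Id C Y"
    using splitsE[OF assms(1) perp_Obj[OF assms(2)]] .
  fix T f assume T: "T \<in> \<T>" and "f \<in> Hom (op_cat C) T Y"
  then have f: "f \<in> Arr C" "Dom C f = Y" "Cod C f = T" by (auto simp: Hom_iff)
  have a0: "a = Zero C X Y" using perpD[OF assms(2), of a] a XY by simp
  have fb: "f \<cdot> b = Zero C Y0 T" using coperpD[OF XY(2), of "f \<cdot> b"] f b T by simp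
  have Y0: "Y0 \<in> Obj C" using b by auto
  have "f = f \<cdot> (a \<cdot> p \<oplus> b \<cdot> r)" using sum f by simp
  also have "\<dots> = Zero C Y T"
    using Comp_extend[OF fb, of r] f p b r a0 T XY Y0 assms(2) perp_Obj
    by (simp del: Comp_Id_simps)
  finally show "f \<in> {Zero (op_cat C) T Y}" by simp
qed (use perp_Obj[OF assms(2)] in \<open>auto simp: Hom_iff\<close>)

lemma splits_iff_two_decomposition: "splits C \<T> \<longleftrightarrow> two_decomposition C \<T> (perp C \<T>)"
proof
  assume splits: "splits C \<T>"
  show "two_decomposition C \<T> (perp C \<T>)"
    unfolding two_decomposition_def
  proof (intro conjI ballI)
    show "\<T> \<subseteq> Obj C" "perp C \<T> \<subseteq> Obj C" using perp_Obj by auto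
    show "iso_closed C \<T>" "iso_closed C (perp C \<T>)" by (rule iso_closed_T iso_closed_perp)+
    fix X Y assume "X \<in> \<T>" "Y \<in> perp C \<T>"
    moreover from this have "Y \<in> perp (op_cat C) \<T>" using splits_perp_subset splits by blast
    ultimately show "Hom C X Y = {Zero C X Y}" "Hom C Y X = {Zero C Y X}"
      by (simp_all add: perp_def)
  next
    fix M assume M: "M \<in> Obj C"
    obtain X Y a b p r where X: "X \<in> \<T>" and Y: "Y \<in> perp C \<T>" "Y \<in> perp (op_cat C) \<T>"
      and a: "a \<in> Arr C" "Dom C a = X" "Cod C a = M"
      and b: "b \<in> Arr C" "Dom C b = Y" "Cod C b = M"
      and p: "p \<in> Arr C" "Dom C p = M" "Cod C p = X"
      and r: "r \<in> Arr C" "Dom C r = M" "Cod C r = Y"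
      and pa: "p \<cdot> a = Id C X" and rb: "r \<cdot> b = Id C Y" and sum: "a \<cdot> p \<oplus> b \<cdot> r = Id C M"
      using splitsE[OF splits M] .
    have ra: "r \<cdot> a = Zero C X Y" using perpD[OF Y(1), of "r \<cdot> a"] r a X by simp
    have pb: "p \<cdot> b = Zero C Y X" using coperpD[OF Y(2), of "p \<cdot> b"] p b X by simp
    have "is_coproduct C X Y M a b"
      unfolding is_coproduct_def
    proof (intro conjI ballI)
      fix Z u v assume Z: "Z \<in> Obj C" and "u \<in> Hom C X Z" "v \<in> Hom C Y Z"
      then have uv: "u \<in> Arr C" "Dom C u = X" "Cod C u = Z" "v \<in> Arr C" "Dom C v = Y" "Cod C v = Z"
        by (auto simp: Hom_iff)
      show "\<exists>!w. w \<in> Hom C M Z \<and> w \<cdot> a = u \<and> w \<cdot> b = v"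
      proof (rule ex1I[of _ "u \<cdot> p \<oplus> v \<cdot> r"])
        show "u \<cdot> p \<oplus> v \<cdot> r \<in> Hom C M Z \<and> (u \<cdot> p \<oplus> v \<cdot> r) \<cdot> a = u \<and> (u \<cdot> p \<oplus> v \<cdot> r) \<cdot> b = v"
          using uv a b p r X perp_Obj[OF Y(1)] by (simp add: Hom_iff pa ra pb rb)
        fix w assume w: "w \<in> Hom C M Z \<and> w \<cdot> a = u \<and> w \<cdot> b = v"
        then have w': "w \<in> Arr C" "Dom C w = M" "Cod C w = Z" and wa: "w \<cdot> a = u" and wb: "w \<cdot> b = v"
          by (auto simp: Hom_iff)
        have "w = w \<cdot> (a \<cdot> p \<oplus> b \<cdot> r)" using sum w' by simp
        also have "\<dots> = u \<cdot> p \<oplus> v \<cdot> r"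
          using w' a b p r by (simp add: Comp_extend[OF wa] Comp_extend[OF wb] del: Comp_Id_simps)
        finally show "w = u \<cdot> p \<oplus> v \<cdot> r" .
      qed
    qed (use a b in \<open>simp_all add: Hom_iff\<close>)
    then show "\<exists>X\<in>\<T>. \<exists>Y\<in>perp C \<T>. \<exists>a b. is_coproduct C X Y M a b" using X Y by blast
  qed
next
  assume dec: "two_decomposition C \<T> (perp C \<T>)"
  show "splits C \<T>"
    unfolding splits_def
  proof
    fix M assume "M \<in> Obj C"
    then obtain X Y a b where X: "X \<in> \<T>" and Y: "Y \<in> perp C \<T>" and ab: "is_coproduct C X Y M a b"
      using dec unfolding two_decomposition_def by blast
    have YO: "Y \<in> Obj C" using perp_Obj[OF Y] .
    have "\<forall>T\<in>\<T>. Hom C Y T = {Zero C Y T}" using dec Y unfolding two_decomposition_def by blast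
    then have Y': "Y \<in> perp (op_cat C) \<T>" using YO by (simp add: perp_def)
    have "a \<in> Hom C X M" "b \<in> Hom C Y M" using ab by (simp_all add: is_coproduct_def)
    moreover obtain p r where "p \<in> Hom C M X" "r \<in> Hom C M Y"
      "p \<cdot> a = Id C X" "r \<cdot> b = Id C Y" "a \<cdot> p \<oplus> b \<cdot> r = Id C M"
      using coproduct_projections[OF ab T_Obj[OF X] YO] .
    ultimately show "\<exists>X\<in>\<T>. \<exists>Y \<in> perp C \<T> \<inter> perp (op_cat C) \<T>.
      \<exists>a\<in>Hom C X M. \<exists>b\<in>Hom C Y M. \<exists>p\<in>Hom C M X. \<exists>r\<in>Hom C M Y.
        p \<cdot> a = Id C X \<and> r \<cdot> b = Id C Y \<and> a \<cdot> p \<oplus> b \<cdot> r = Id C M"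
      using X Y Y' by blast
  qed
qed

end

section \<open>Triangles in the stable category\<close>

context serre
begin

lemma preenvelopeE:
  assumes "preenvelope C \<T> M i" "f \<in> Arr C" "Dom C f = M" "Cod C f \<in> \<T>"
  obtains h where "h \<in> Arr C" "Dom C h = Cod C i" "Cod C h = Cod C f" "h \<cdot> i = f"
proof -
  have "f \<in> Hom C M (Cod C f)" using assms by (simp add: Hom_iff)
  then obtain h where "h \<in> Hom C (Cod C i) (Cod C f)" "h \<cdot> i = f"
    using assms unfolding preenvelope_def by blast
  then show thesis using that[of h] by (simp add: Hom_iff)
qed

lemma pushout_factor:
  assumes "is_pushout C i f t g" "u \<in> Arr C" "Dom C u = Cod C i" "v \<in> Arr C" "Dom C v = Cod C f"
    "Cod C v = Cod C u" "u \<cdot> i = v \<cdot> f"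
  obtains w where "w \<in> Arr C" "Dom C w = Cod C t" "Cod C w = Cod C u" "w \<cdot> t = u" "w \<cdot> g = v"
proof -
  have "u \<in> Hom C (Cod C i) (Cod C u)" "v \<in> Hom C (Cod C f) (Cod C u)" "Cod C u \<in> Obj C"
    using assms by (simp_all add: Hom_iff)
  then obtain w where "w \<in> Hom C (Cod C t) (Cod C u)" "w \<cdot> t = u" "w \<cdot> g = v"
    using assms(1,7) unfolding is_pushout_def by blast
  then show thesis using that[of w] by (simp add: Hom_iff)
qed

lemma pushout_eqI:
  assumes "is_pushout C i f t g" "x \<in> Arr C" "y \<in> Arr C" "Dom C x = Cod C t" "Dom C y = Cod C t"
    "Cod C y = Cod C x" "x \<cdot> t = y \<cdot> t" "x \<cdot> g = y \<cdot> g"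
  shows "x = y"
proof -
  have h: "i \<in> Arr C" "f \<in> Arr C" "t \<in> Arr C" "g \<in> Arr C" "Dom C t = Cod C i" "Dom C g = Cod C f"
    "Cod C g = Cod C t" "t \<cdot> i = g \<cdot> f"
    using assms(1) unfolding is_pushout_def Hom_iff by blast+
  have "x \<cdot> t \<in> Hom C (Cod C i) (Cod C x)" "x \<cdot> g \<in> Hom C (Cod C f) (Cod C x)" "Cod C x \<in> Obj C"
    using assms h by (simp_all add: Hom_iff)
  moreover have "(x \<cdot> t) \<cdot> i = (x \<cdot> g) \<cdot> f"
  proof -
    have "Dom C i = Dom C f" using assms(1) unfolding is_pushout_def by blast
    then show ?thesis using assms(2,4) h by simp
  qed
  ultimately have "\<exists>!w. w \<in> Hom C (Cod C t) (Cod C x) \<and> w \<cdot> t = x \<cdot> t \<and> w \<cdot> g = x \<cdot> g"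
    using assms(1) unfolding is_pushout_def by blast
  moreover have "x \<in> Hom C (Cod C t) (Cod C x)" "y \<in> Hom C (Cod C t) (Cod C x)"
    using assms by (simp_all add: Hom_iff)
  ultimately show ?thesis using assms(7,8) by metis
qed

text \<open>The cokernel of \<open>t\<close> is a quotient of the cokernel of the opposite side \<open>f\<close>, and the image of
  \<open>t\<close> is a quotient of the codomain of \<open>i\<close>; the corner of the pushout is an extension of the one by
  the other.\<close>

lemma pushout_in_T:
  assumes po: "is_pushout C i f t g" and i: "Cod C i \<in> \<T>" and c: "is_cokernel C f c" "Cod C c \<in> \<T>"
  shows "Cod C t \<in> \<T>"
proof -
  have h: "i \<in> Arr C" "f \<in> Arr C" "t \<in> Arr C" "g \<in> Arr C" "Dom C t = Cod C i" "Dom C g = Cod C f"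
    "Cod C g = Cod C t" "t \<cdot> i = g \<cdot> f" "Dom C f = Dom C i"
    using po unfolding is_pushout_def Hom_iff by simp_all
  note c' = is_cokernelD[OF c(1)]
  obtain d where d: "is_cokernel C t d" using ex_cokernel h by blast
  note d' = is_cokernelD[OF d]
  have "d \<cdot> (g \<cdot> f) = Zero C (Dom C f) (Cod C d)"
    using Comp_extend[OF d'(4), of i] h d' by simp
  then obtain w where w: "w \<in> Arr C" "Dom C w = Cod C c" "Cod C w = Cod C d" "w \<cdot> c = d \<cdot> g"
    using cokernel_factor[OF c(1), of "d \<cdot> g"] h d' by auto
  have "epic C w"
    unfolding epic_def
  proof (intro conjI ballI impI)
    fix Z x y assume "x \<in> Hom C (Cod C w) Z" "y \<in> Hom C (Cod C w) Z" and eq: "x \<cdot> w = y \<cdot> w"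
    then have xy: "x \<in> Arr C" "y \<in> Arr C" "Dom C x = Cod C d" "Dom C y = Cod C d" "Cod C y = Cod C x"
      using w by (auto simp: Hom_iff)
    have xydg: "x \<cdot> (d \<cdot> g) = y \<cdot> (d \<cdot> g)"
      using Comp_extend[OF eq, of c] xy w c' by simp
    have "x \<cdot> d = y \<cdot> d"
      by (rule pushout_eqI[OF po]) (use xydg xy d' h in simp_all)
    then show "x = y" by (rule epicD[OF cokernel_epic[OF d]]) (use xy d' in simp_all)
  qed (rule w)
  then have "Cod C d \<in> \<T>" using T_quotient[of w] w c by simp
  moreover obtain m where m: "is_kernel C m d" using ex_kernel d' by blast
  moreover obtain e where "epic C e" "Dom C e = Dom C t" "Cod C e = Dom C m"
    using image_factorization[OF d m] .
  then have "Dom C m \<in> \<T>" using T_quotient[of e] h i by simp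
  ultimately show ?thesis using T_extension[OF m] d' by simp
qed

text \<open>The third object of the standard right triangle on \<open>f\<close> is the pushout of a preenvelope along
  \<open>f\<close>. It lies in \<open>\<T>\<close> if the cokernel of \<open>f\<close> does, and is then zero in the stable
  category.\<close>

lemma right_triangle_zero_cone:
  assumes choice: "preenvelope_choice C \<T> i q" and f: "f \<in> Arr C"
    and c: "is_cokernel C f c" "Cod C c \<in> \<T>"
  shows "\<exists>Z. zero_object \<S> Z \<and> (\<exists>G\<in>Hom \<S> (Cod C f) Z. \<exists>H\<in>Hom \<S> Z (Cod C (q (Dom C f))).
    right_triangle C \<T> i q (cls f) G H)"
proof -
  let ?M = "Dom C f" and ?N = "Cod C f"
  have "preenvelope C \<T> ?M (i ?M)" and iq: "is_cokernel C (i ?M) (q ?M)"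
    using choice f by (simp_all add: preenvelope_choice_def)
  then have i: "i ?M \<in> Arr C" "Dom C (i ?M) = ?M" "Cod C (i ?M) \<in> \<T>"
    by (simp_all add: preenvelope_def)
  note q = is_cokernelD[OF iq]
  obtain t g where po: "is_pushout C (i ?M) f t g" using ex_pushout[of "i ?M" f] i f by auto
  then have t: "t \<in> Arr C" "Dom C t = Cod C (i ?M)" and g: "g \<in> Arr C" "Dom C g = ?N" "Cod C g = Cod C t"
    unfolding is_pushout_def Hom_iff by simp_all
  let ?P = "Cod C t"
  have P: "?P \<in> \<T>" by (rule pushout_in_T[OF po i(3) c])
  let ?z = "Zero C ?N (Cod C (q ?M))"
  have "q ?M \<cdot> i ?M = ?z \<cdot> f" using q i f by simp
  then obtain h where h: "h \<in> Arr C" "Dom C h = ?P" "Cod C h = Cod C (q ?M)" "h \<cdot> t = q ?M" "h \<cdot> g = ?z"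
    using pushout_factor[OF po q(1), of ?z] q f by auto
  have std: "standard_right_triangle C \<T> i q (cls f) (cls g) (cls h)"
    unfolding standard_right_triangle_def
    by (rule bexI[of _ ?M], rule bexI[of _ ?N], rule bexI[of _ ?P], rule bexI[of _ f],
        rule bexI[of _ g], rule bexI[of _ t], rule bexI[of _ h])
      (use po h t g f in \<open>simp_all add: Hom_iff\<close>)
  have susp: "is_suspension_of C \<T> i q (cls (Id C (Cod C (q ?M)))) (cls (Id C ?M))"
    unfolding is_suspension_of_def
    by (rule bexI[of _ ?M], rule bexI[of _ ?M], rule bexI[of _ "Id C ?M"],
        rule bexI[of _ "Id C (Cod C (i ?M))"], rule bexI[of _ "Id C (Cod C (q ?M))"])
      (use i q f in \<open>simp_all add: Hom_iff\<close>)
  have isom: "is_isom \<S> (cls (Id C K))" if "K \<in> Obj C" for K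
    unfolding stable_is_isom_iff[OF Id_simps(1)[OF that]]
    by (rule bexI[of _ "Id C K"]) (use that in simp_all)
  \<comment> \<open>a standard triangle is a triangle, by means of identities\<close>
  have isos: "\<exists>A\<in>Hom \<S> ?M ?M. \<exists>B\<in>Hom \<S> ?N ?N. \<exists>D\<in>Hom \<S> ?P ?P.
      \<exists>S\<in>Hom \<S> (Cod C (q ?M)) (Cod C (q ?M)).
        is_isom \<S> A \<and> is_isom \<S> B \<and> is_isom \<S> D \<and> is_isom \<S> S \<and> is_suspension_of C \<T> i q S A \<and>
        cls f \<cdot>\<^bsub>\<S>\<^esub> A = B \<cdot>\<^bsub>\<S>\<^esub> cls f \<and> cls g \<cdot>\<^bsub>\<S>\<^esub> B = D \<cdot>\<^bsub>\<S>\<^esub> cls g \<and>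
        cls h \<cdot>\<^bsub>\<S>\<^esub> D = S \<cdot>\<^bsub>\<S>\<^esub> cls h"
    by (rule bexI[of _ "cls (Id C ?M)"], rule bexI[of _ "cls (Id C ?N)"],
        rule bexI[of _ "cls (Id C ?P)"], rule bexI[of _ "cls (Id C (Cod C (q ?M)))"])
      (use susp isom h(1-3) t g f q in simp_all)
  have "\<exists>F'\<in>Hom \<S> ?M ?N. \<exists>G'\<in>Hom \<S> ?N ?P. \<exists>H'\<in>Hom \<S> ?P (Cod C (q ?M)).
      standard_right_triangle C \<T> i q F' G' H' \<and>
      (\<exists>A\<in>Hom \<S> ?M ?M. \<exists>B\<in>Hom \<S> ?N ?N. \<exists>D\<in>Hom \<S> ?P ?P.
      \<exists>S\<in>Hom \<S> (Cod C (q ?M)) (Cod C (q ?M)).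
        is_isom \<S> A \<and> is_isom \<S> B \<and> is_isom \<S> D \<and> is_isom \<S> S \<and> is_suspension_of C \<T> i q S A \<and>
        F' \<cdot>\<^bsub>\<S>\<^esub> A = B \<cdot>\<^bsub>\<S>\<^esub> cls f \<and> G' \<cdot>\<^bsub>\<S>\<^esub> B = D \<cdot>\<^bsub>\<S>\<^esub> cls g \<and>
        H' \<cdot>\<^bsub>\<S>\<^esub> D = S \<cdot>\<^bsub>\<S>\<^esub> cls h)"
    by (rule bexI[of _ "cls f"], rule bexI[of _ "cls g"], rule bexI[of _ "cls h"],
        rule conjI[OF std isos]) (use h t g f in simp_all)
  moreover have "cls f \<in> Hom \<S> ?M ?N" "cls g \<in> Hom \<S> ?N ?P" "cls h \<in> Hom \<S> ?P (Cod C (q ?M))"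
    "?M \<in> Obj C" "?N \<in> Obj C" "?P \<in> Obj C"
    using f g h t by simp_all
  ultimately have "right_triangle C \<T> i q (cls f) (cls g) (cls h)"
    unfolding right_triangle_def Let_def by blast
  moreover have "zero_object \<S> ?P" using stable_zero_objectI P .
  moreover have "cls g \<in> Hom \<S> ?N ?P" "cls h \<in> Hom \<S> ?P (Cod C (q ?M))" using g h by simp_all
  ultimately show ?thesis by blast
qed

text \<open>The second morphism \<open>g\<close> of a standard right triangle is a weak cokernel of the first: if
  \<open>v \<cdot> f'\<close> is small, it extends along the preenvelope that starts at the domain of \<open>f'\<close>,
  and the pushout property makes \<open>v\<close> factor through \<open>g\<close>. If \<open>g\<close> is stably zero, this forces \<open>v\<close> to be stably zero.
  The stable isomorphisms \<open>\<alpha>\<close> and \<open>\<beta>\<close> transport this to all right triangles.\<close>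

lemma right_triangle_zero_cone_epic:
  assumes choice: "preenvelope_choice C \<T> i q" and tri: "right_triangle C \<T> i q F G H"
    and G: "G \<in> Hom \<S> N Z" "zero_object \<S> Z"
  shows "epic \<S> F"
proof -
  obtain L M N L' M' N' F' G' H' A B D where F: "F \<in> Hom \<S> L M" and "G \<in> Hom \<S> M N"
    and F': "F' \<in> Hom \<S> L' M'" and G': "G' \<in> Hom \<S> M' N'"
    and std: "standard_right_triangle C \<T> i q F' G' H'"
    and A: "A \<in> Hom \<S> L L'" "is_isom \<S> A" and B: "B \<in> Hom \<S> M M'" "is_isom \<S> B"
    and D: "D \<in> Hom \<S> N N'"
    and FA: "F' \<cdot>\<^bsub>\<S>\<^esub> A = B \<cdot>\<^bsub>\<S>\<^esub> F" and GB: "G' \<cdot>\<^bsub>\<S>\<^esub> B = D \<cdot>\<^bsub>\<S>\<^esub> G"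
    using tri unfolding right_triangle_def Let_def by (elim bexE conjE)
  obtain f where f: "f \<in> Arr C" "Dom C f = L" "Cod C f = M" "F = cls f" using stable_HomE[OF F] .
  obtain \<gamma> where \<gamma>: "\<gamma> \<in> Arr C" "Dom C \<gamma> = M" "Cod C \<gamma> = N" "G = cls \<gamma>"
    using stable_HomE[OF \<open>G \<in> Hom \<S> M N\<close>] .
  obtain \<alpha> where \<alpha>: "\<alpha> \<in> Arr C" "Dom C \<alpha> = L" "Cod C \<alpha> = L'" "A = cls \<alpha>" using stable_HomE[OF A(1)] .
  obtain \<beta> where \<beta>: "\<beta> \<in> Arr C" "Dom C \<beta> = M" "Cod C \<beta> = M'" "B = cls \<beta>" using stable_HomE[OF B(1)] .
  obtain \<delta> where \<delta>: "\<delta> \<in> Arr C" "Dom C \<delta> = N" "Cod C \<delta> = N'" "D = cls \<delta>" using stable_HomE[OF D] .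
  obtain L0 M0 N0 f' g t h where L0: "L0 \<in> Obj C" and "f' \<in> Hom C L0 M0" "g \<in> Hom C M0 N0"
    "t \<in> Hom C (Cod C (i L0)) N0" and po: "is_pushout C (i L0) f' t g"
    and F'f: "F' = cls f'" and G'g: "G' = cls g"
    using std unfolding standard_right_triangle_def by (elim bexE conjE)
  then have f': "f' \<in> Arr C" "Dom C f' = L'" "Cod C f' = M'" "L0 = L'"
    and g: "g \<in> Arr C" "Dom C g = M'" "Cod C g = N'" and t: "t \<in> Arr C" "Cod C t = N'"
    using F' G' by (auto simp: Hom_iff)
  have i: "preenvelope C \<T> L' (i L')" using choice L0 f' by (simp add: preenvelope_choice_def)
  then have i': "i L' \<in> Arr C" "Dom C (i L') = L'" by (simp_all add: preenvelope_def)
  have f'\<alpha>: "f' \<cdot> \<alpha> \<approx> \<beta> \<cdot> f" using FA f \<alpha> \<beta> f' F'f by (simp add: cls_eq_iff)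
  have g\<beta>: "g \<cdot> \<beta> \<approx> \<delta> \<cdot> \<gamma>" using GB g \<beta> \<gamma> \<delta> G'g by (simp add: cls_eq_iff)
  have "N = Z" using \<gamma> G(1) by simp
  then have "small \<gamma>" using stable_zero_objectD[OF G(2)] \<gamma> by simp
  then have small_g\<beta>: "small (g \<cdot> \<beta>)"
    using small_cong[OF g\<beta>] small_Comp_left[of \<gamma> \<delta>] \<gamma> \<delta> by simp
  obtain \<alpha>' where \<alpha>': "\<alpha>' \<in> Arr C" "Dom C \<alpha>' = L'" "Cod C \<alpha>' = L" "\<alpha> \<cdot> \<alpha>' \<approx> Id C L'"
    using A(2) \<alpha> by (auto simp: stable_is_isom_iff)
  obtain \<beta>' where \<beta>': "\<beta>' \<in> Arr C" "Dom C \<beta>' = M'" "Cod C \<beta>' = M" "\<beta>' \<cdot> \<beta> \<approx> Id C M"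
    using B(2) \<beta> by (auto simp: stable_is_isom_iff)
  have L'M: "L' \<in> Obj C" "M \<in> Obj C" using L0 f'(4) f by auto
  \<comment> \<open>\<open>u \<cdot> f\<close> small is thereby turned into \<open>u \<cdot> \<beta>' \<cdot> f'\<close> small, which concerns the standard triangle\<close>
  have key: "\<beta>' \<cdot> f' \<approx> f \<cdot> \<alpha>'"
  proof -
    have "\<beta>' \<cdot> f' = (\<beta>' \<cdot> f') \<cdot> Id C L'" using \<beta>' f' L'M by simp
    also have "\<dots> \<approx> (\<beta>' \<cdot> f') \<cdot> (\<alpha> \<cdot> \<alpha>')"
      by (rule sim_Comp[OF sim_sym[OF \<alpha>'(4)]]) (use \<beta>' f' \<alpha> \<alpha>' L'M in simp_all)
    also have "\<dots> = \<beta>' \<cdot> ((f' \<cdot> \<alpha>) \<cdot> \<alpha>')" using \<beta>' f' \<alpha> \<alpha>' by simp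
    also have "\<dots> \<approx> \<beta>' \<cdot> ((\<beta> \<cdot> f) \<cdot> \<alpha>')"
      by (intro sim_Comp f'\<alpha> sim_refl) (use \<beta>' f' \<alpha> \<alpha>' \<beta> f in simp_all)
    also have "\<dots> = (\<beta>' \<cdot> \<beta>) \<cdot> (f \<cdot> \<alpha>')" using \<beta>' \<alpha>' \<beta> f by simp
    also have "\<dots> \<approx> Id C M \<cdot> (f \<cdot> \<alpha>')"
      by (intro sim_Comp \<beta>'(4) sim_refl) (use \<beta>' \<alpha>' \<beta> f L'M in simp_all)
    also have "\<dots> = f \<cdot> \<alpha>'" using \<alpha>' f by simp
    finally show ?thesis .
  qed
  show ?thesis
    unfolding f(4) stable_epic_iff[OF f(1)]
  proof (intro ballI impI)
    fix u assume u: "u \<in> Arr C" "Dom C u = Cod C f" "small (u \<cdot> f)"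
    have "u \<cdot> (\<beta>' \<cdot> f') \<approx> u \<cdot> (f \<cdot> \<alpha>')"
      by (rule sim_Comp[OF key]) (use u f \<beta>' f' in simp_all)
    moreover have "small (u \<cdot> (f \<cdot> \<alpha>'))"
      using small_Comp_right[OF u(3), of \<alpha>'] u f \<alpha>' by simp
    ultimately have "small (u \<cdot> (\<beta>' \<cdot> f'))" by (rule small_cong)
    moreover have u\<beta>f: "u \<cdot> (\<beta>' \<cdot> f') \<in> Arr C" "Dom C (u \<cdot> (\<beta>' \<cdot> f')) = L'"
      "Cod C (u \<cdot> (\<beta>' \<cdot> f')) = Cod C u" using u f \<beta>' f' by simp_all
    ultimately obtain x y where xy: "x \<in> Arr C" "y \<in> Arr C" "Dom C x = L'" "Cod C y = Cod C u"
      "Dom C y = Cod C x" "Cod C x \<in> \<T>" "y \<cdot> x = u \<cdot> (\<beta>' \<cdot> f')"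
      using smallE[of "u \<cdot> (\<beta>' \<cdot> f')"] by metis
    obtain x' where x': "x' \<in> Arr C" "Dom C x' = Cod C (i L')" "Cod C x' = Cod C x" "x' \<cdot> i L' = x"
      using preenvelopeE[OF i xy(1,3,6)] .
    have "(y \<cdot> x') \<cdot> i L' = (u \<cdot> \<beta>') \<cdot> f'"
      using xy x' u f \<beta>' f' i' by simp
    then obtain w where w: "w \<in> Arr C" "Dom C w = N'" "Cod C w = Cod C u" "w \<cdot> g = u \<cdot> \<beta>'"
      using pushout_factor[OF po, of "y \<cdot> x'" "u \<cdot> \<beta>'"] xy x' u f \<beta>' f' t by auto
    have "u = u \<cdot> Id C M" using u f by simp
    also have "\<dots> \<approx> u \<cdot> (\<beta>' \<cdot> \<beta>)"
      by (rule sim_Comp[OF sim_sym[OF \<beta>'(4)]]) (use u f \<beta> \<beta>' L'M in simp_all)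
    also have "u \<cdot> (\<beta>' \<cdot> \<beta>) = w \<cdot> (g \<cdot> \<beta>)"
      using Comp_extend[OF w(4), of \<beta>] w(1-3) u f \<beta> \<beta>' g by simp
    finally have "u \<approx> w \<cdot> (g \<cdot> \<beta>)" .
    moreover have "small (w \<cdot> (g \<cdot> \<beta>))"
      using small_Comp_left[OF small_g\<beta>, of w] w g \<beta> by simp
    ultimately show "small u" by (rule small_cong)
  qed
qed

lemma preenvelope_choice_op_cat [simp]:
  "preenvelope_choice (op_cat C) \<T> j k \<longleftrightarrow> precover_choice C \<T> j k"
  by (simp add: preenvelope_choice_def precover_choice_def precover_def)

text \<open>A right triangle with zero third term makes its first morphism epic, and a left triangle is a right
  triangle of the opposite category.\<close>

lemma balanced_imp_weakly_balanced:
  assumes "balanced \<S>" "preenvelope_choice C \<T> i q" "precover_choice C \<T> j k"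
  shows "weakly_balanced C \<T> i q j k"
  unfolding weakly_balanced_def Let_def
proof (intro ballI impI, elim conjE exE bexE)
  fix M N F Z H G Z' G' H'
  assume F: "F \<in> Hom \<S> M N" and Z: "zero_object \<S> Z" "G \<in> Hom \<S> Z M" "left_triangle C \<T> j k H G F"
    and Z': "zero_object \<S> Z'" "G' \<in> Hom \<S> N Z'" "right_triangle C \<T> i q F G' H'"
  have "epic \<S> F" by (rule right_triangle_zero_cone_epic[OF assms(2) Z'(3,2,1)])
  moreover have "epic (stable_cat (op_cat C) \<T>) F"
    by (rule serre.right_triangle_zero_cone_epic[OF serre_op_cat, of j k F G H M Z])
      (use assms(3) Z in \<open>simp_all add: left_triangle_def\<close>)
  ultimately show "is_isom \<S> F" using assms(1) F by (simp add: balanced_def Hom_def)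
qed

lemma weakly_balanced_imp_serre_isomorphism_invertible:
  assumes wb: "weakly_balanced C \<T> i q j k"
    and iq: "preenvelope_choice C \<T> i q" and jk: "precover_choice C \<T> j k"
    and f: "serre_isomorphism C \<T> f"
  shows "is_isom \<S> (cls f)"
proof -
  obtain \<kappa> c where \<kappa>: "is_kernel C \<kappa> f" "Dom C \<kappa> \<in> \<T>" and c: "is_cokernel C f c" "Cod C c \<in> \<T>"
    using f unfolding serre_isomorphism_def by blast
  have fA: "f \<in> Arr C" using is_kernelD[OF \<kappa>(1)] by simp
  have right: "\<exists>Z. zero_object \<S> Z \<and> (\<exists>G\<in>Hom \<S> (Cod C f) Z. \<exists>H\<in>Hom \<S> Z (Cod C (q (Dom C f))).
      right_triangle C \<T> i q (cls f) G H)"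
    by (rule right_triangle_zero_cone[OF iq fA c])
  have left: "\<exists>Z. zero_object \<S> Z \<and> (\<exists>G\<in>Hom \<S> Z (Dom C f). \<exists>H\<in>Hom \<S> (Dom C (k (Cod C f))) Z.
      left_triangle C \<T> j k H G (cls f))"
    using serre.right_triangle_zero_cone[OF serre_op_cat, of j k f \<kappa>] jk fA \<kappa>
    by (simp add: left_triangle_def)
  have "cls f \<in> Hom \<S> (Dom C f) (Cod C f)" "Dom C f \<in> Obj C" "Cod C f \<in> Obj C" using fA by simp_all
  then show ?thesis using wb left right unfolding weakly_balanced_def Let_def by blast
qed

end

section \<open>Equivalence of the three conditions\<close>

theorem corollary2p3p4:
  fixes C :: "('o, 'm) additive_cat" and \<T> :: "'o set"
    and i q j k :: "'o \<Rightarrow> 'm"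
  assumes "abelian_category C"
    and "serre_class C \<T>"
    and "functorially_finite C \<T> \<Longrightarrow>
      preenvelope_choice C \<T> i q \<and> precover_choice C \<T> j k"
  shows "(contravariantly_finite C \<T> \<and> balanced (stable_cat C \<T>) \<longleftrightarrow>
          functorially_finite C \<T> \<and> weakly_balanced C \<T> i q j k) \<and>
         (covariantly_finite C \<T> \<and> balanced (stable_cat C \<T>) \<longleftrightarrow>
          functorially_finite C \<T> \<and> weakly_balanced C \<T> i q j k) \<and>
         (functorially_finite C \<T> \<and> weakly_balanced C \<T> i q j k \<longleftrightarrow>
          two_decomposition C \<T> (perp C \<T>))"
proof (cases "\<T> = {}")
  case True
  \<comment> \<open>no precovers, preenvelopes or summands in \<open>\<T>\<close> exist, although there are objects\<close>
  interpret abelian_category C by (rule assms(1))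
  obtain Z where "Z \<in> Obj C" using ex_zero_object by (auto simp: zero_object_def)
  then have "\<not> covariantly_finite C \<T>" "\<not> contravariantly_finite C \<T>"
    "\<not> two_decomposition C \<T> (perp C \<T>)"
    using True unfolding covariantly_finite_def contravariantly_finite_def precover_def
      preenvelope_def two_decomposition_def by auto
  then show ?thesis by (simp add: functorially_finite_def)
next
  case False
  then interpret serre C \<T>
    using assms(1,2) by (simp add: serre_def serre_axioms_def abelian_def)
  have dec: "two_decomposition C \<T> (perp C \<T>) \<longleftrightarrow> splits C \<T>"
    by (simp add: splits_iff_two_decomposition)
  have weak: "functorially_finite C \<T> \<and> weakly_balanced C \<T> i q j k \<longleftrightarrow> splits C \<T>"
  proof
    assume "functorially_finite C \<T> \<and> weakly_balanced C \<T> i q j k"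
    then show "splits C \<T>"
      using splits_if_contravariantly_finite weakly_balanced_imp_serre_isomorphism_invertible assms(3)
      unfolding functorially_finite_def by blast
  next
    assume "splits C \<T>"
    then show "functorially_finite C \<T> \<and> weakly_balanced C \<T> i q j k"
      using splits_imp_functorially_finite splits_imp_balanced balanced_imp_weakly_balanced assms(3)
      by blast
  qed
  have strong: "contravariantly_finite C \<T> \<and> balanced \<S> \<longleftrightarrow> splits C \<T>"
    "covariantly_finite C \<T> \<and> balanced \<S> \<longleftrightarrow> splits C \<T>"
    using splits_if_contravariantly_finite splits_if_covariantly_finite
      balanced_imp_serre_isomorphism_invertible splits_imp_functorially_finite splits_imp_balanced
    unfolding functorially_finite_def by blast+
  show ?thesis using dec weak strong by simp
qed

end
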